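(* Let $\mathcal{K}\subseteq[0,1]^n$ be a convex set with diameter $D$, and for every $1\leq t\leq T$ let $F_t\colon[0,1]^n\to\mathbb{R}_{\geq0}$ be a non-negative $\beta$-smooth DR-submodular function (chosen by an adversary). Let $\mathbf{y}^{(1)},\dots,\mathbf{y}^{(T)}$ be the vectors played by the algorithm NMMFW$(L,\varepsilon,T)$ described in the context. Then \[ \sum_{t=1}^T\mathbb{E}[F_t(\mathbf{y}^{(t)})]\geq(1-2\varepsilon)^{L-1}\big[(1+\varepsilon)^L-1\big]\Big(1-\min_{\mathbf{x}\in\mathcal{K}}\|\mathbf{x}\|_\infty\Big)\mathbb{E}\Big[\sum_{t=1}^TF_t(\mathbf{o})\Big]-\varepsilon L\cdot\mathcal{R}(T)-0.5\varepsilon^2\beta D^2TL, \] where $\mathbf{o}$ is a vector in $\mathcal{K}$ maximizing $\mathbb{E}[\sum_{t=1}^TF_t(\mathbf{o})]$ and $\mathcal{R}(T)$ is the regret of the online linear optimization algorithm over $\mathcal{K}$ when the adversarial vectors are the estimators $\mathbf{g}^{(i,t)}$ computed by the algorithm. In particular, when $L=\lfloor\ln2/\varepsilon\rfloor$, $\varepsilon=1/\sqrt T$ and each $\mathcal{E}_i$ is an instance of Regularized-Follow-the-Leader, \[ \sum_{t=1}^T\mathbb{E}[F_t(\mathbf{y}^{(t)})]\geq\Big(\tfrac14-3\varepsilon\Big)\Big(1-\min_{\mathbf{x}\in\mathcal{K}}\|\mathbf{x}\|_\infty\Big)\mathbb{E}\Big[\sum_{t=1}^TF_t(\mathbf{o})\Big]-(G+\beta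 D)D\sqrt T, \] where $G=\max_{1\leq i\leq L,1\leq t\leq T}\|\mathbf{g}^{(i,t)}\|_2$.
   Context: DR-submodular: for all $\mathbf{a}\leq\mathbf{b}$ in $[0,1]^n$, $k>0$, coordinate $i$ with $\mathbf{b}+k\mathbf{e}_i\in[0,1]^n$, $F(\mathbf{a}+k\mathbf{e}_i)-F(\mathbf{a})\geq F(\mathbf{b}+k\mathbf{e}_i)-F(\mathbf{b})$. $\beta$-smooth: continuously differentiable with $\|\nabla F(\mathbf{x})-\nabla F(\mathbf{y})\|_2\leq\beta\|\mathbf{x}-\mathbf{y}\|_2$. Online setting: at each step $t\in[T]$ the algorithm chooses $\mathbf{y}^{(t)}\in\mathcal{K}$ before $F_t$ is revealed. An online linear optimization algorithm $\mathcal{E}$ over $\mathcal{K}$, in each step $t\in[T]$, selects $\mathbf{u}^{(t)}\in\mathcal{K}$, after which an adversary reveals a vector $\mathbf{d}^{(t)}$ chosen independently of $\mathbf{u}^{(t)}$; it has regret $\mathcal{R}(T)$ if $\mathbb{E}[\sum_t\langle\mathbf{u}^{(t)},\mathbf{d}^{(t)}\rangle]\geq\max_{\mathbf{x}\in\mathcal{K}}\mathbb{E}[\sum_t\langle\mathbf{x},\mathbf{d}^{(t)}\rangle]-\mathcal{R}(T)$. Regularized-Follow-the-Leader (Abernethy et al.) is such an algorithm with $\mathcal{R}(T)\leq DG'\sqrt{2T}$ where $G'=\max_t\|\mathbf{d}^{(t)}\|_2$. Algorithm NMMFW$(L,\varepsilon,T)$: initialize instances $\mathcal{E}_1,\dots,\mathcal{E}_L$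 of an online linear optimization algorithm over $\mathcal{K}$. For $t=1,\dots,T$: set $\mathbf{y}^{(0,t)}\in\arg\min_{\mathbf{x}\in\mathcal{K}}\|\mathbf{x}\|_\infty$; for $i=1,\dots,L$, let $\mathbf{s}^{(i,t)}\in\mathcal{K}$ be the vector picked by $\mathcal{E}_i$ at step $t$ and $\mathbf{y}^{(i,t)}=(1-\varepsilon)\mathbf{y}^{(i-1,t)}+\varepsilon\mathbf{s}^{(i,t)}$; play $\mathbf{y}^{(t)}=\mathbf{y}^{(L,t)}$; then for $i=1,\dots,L$, observe an unbiased estimator $\mathbf{g}^{(i,t)}$ of $\nabla F_t(\mathbf{y}^{(i-1,t)})$ (i.e., $\mathbb{E}[\mathbf{g}^{(i,t)}\mid\mathbf{y}^{(i-1,t)}]=\nabla F_t(\mathbf{y}^{(i-1,t)})$) and pass it to $\mathcal{E}_i$ as its adversarial vector $\mathbf{d}^{(t)}$.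
   Formalization: The first bound is stated for 0 < ε ≤ 1/2 and non-negative R(T), and the estimators g^(i,t) are unbiased conditionally on F_t, y^(i-1,t) and also the vector s^(i,t) picked by E_i; without these the claim fails. RFTL is taken with the tuning that gives regret DG√(2T). *)

theory Defs
  imports "HOL-Probability.Probability"
begin

definition DR_submodular :: "(real ^ 'n \<Rightarrow> real) \<Rightarrow> bool" where
  "DR_submodular f \<longleftrightarrow>
     (\<forall>a \<in> cbox 0 1. \<forall>b \<in> cbox 0 1. \<forall>k > 0. \<forall>i.
        a \<le> b \<longrightarrow> b + k *\<^sub>R axis i 1 \<in> cbox 0 1 \<longrightarrow>
        f (a + k *\<^sub>R axis i 1) - f a \<ge> f (b + k *\<^sub>R axis i 1) - f b)"

text \<open>The derivative is taken within the cube, so that it is meaningful (and still unique) at boundary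
  points and does not depend on the values of the function outside the cube.\<close>

definition cube_gradient :: "(real ^ 'n \<Rightarrow> real) \<Rightarrow> real ^ 'n \<Rightarrow> real ^ 'n" where
  "cube_gradient f x = (THE v. (f has_derivative (\<lambda>h. v \<bullet> h)) (at x within cbox 0 1))"

definition smooth_on_cube :: "real \<Rightarrow> (real ^ 'n \<Rightarrow> real) \<Rightarrow> bool" where
  "smooth_on_cube \<beta> f \<longleftrightarrow>
     f differentiable_on cbox 0 1 \<and>
     continuous_on (cbox 0 1) (cube_gradient f) \<and>
     (\<forall>x \<in> cbox 0 1. \<forall>y \<in> cbox 0 1.
        norm (cube_gradient f x - cube_gradient f y) \<le> \<beta> * norm (x - y))"

text \<open>An online linear optimization algorithm is a map from the list of adversarial vectors revealed so
  far (oldest first) to the next vector it selects; a randomized one additionally depends on the sample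
  point. The regret is that of one concrete run, in which \<open>u t\<close> is selected and \<open>d t\<close> is revealed
  in step \<open>t\<close>.\<close>

type_synonym ('w, 'n) olo = "'w \<Rightarrow> (real ^ 'n) list \<Rightarrow> real ^ 'n"

definition has_regret ::
  "'w measure \<Rightarrow> (real ^ 'n) set \<Rightarrow> nat \<Rightarrow> (nat \<Rightarrow> 'w \<Rightarrow> real ^ 'n) \<Rightarrow> (nat \<Rightarrow> 'w \<Rightarrow> real ^ 'n) \<Rightarrow> real \<Rightarrow> bool"
where
  "has_regret M K T u d R \<longleftrightarrow>
     prob_space.expectation M (\<lambda>\<omega>. \<Sum>t=1..T. u t \<omega> \<bullet> d t \<omega>)
       \<ge> (SUP x\<in>K. prob_space.expectation M (\<lambda>\<omega>. \<Sum>t=1..T. x \<bullet> d t \<omega>)) - R"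

definition strongly_convex_on :: "(real ^ 'n) set \<Rightarrow> (real ^ 'n \<Rightarrow> real) \<Rightarrow> bool" where
  "strongly_convex_on K \<Phi> \<longleftrightarrow>
     (\<forall>x \<in> K. \<forall>y \<in> K. \<forall>u \<ge> 0. \<forall>v \<ge> 0. u + v = 1 \<longrightarrow>
        \<Phi> (u *\<^sub>R x + v *\<^sub>R y) \<le> u * \<Phi> x + v * \<Phi> y - u * v / 2 * (norm (x - y))\<^sup>2)"

definition follows_regularized_leader ::
  "(real ^ 'n) set \<Rightarrow> (real ^ 'n \<Rightarrow> real) \<Rightarrow> real \<Rightarrow> ((real ^ 'n) list \<Rightarrow> real ^ 'n) \<Rightarrow> bool" where
  "follows_regularized_leader K \<Phi> \<eta> A \<longleftrightarrow>
     (\<forall>ds. is_arg_max (\<lambda>x. \<eta> * (\<Sum>d\<leftarrow>ds. x \<bullet> d) - \<Phi> x) (\<lambda>x. x \<in> K) (A ds))"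

text \<open>Regularized-Follow-the-Leader with a regularizer that is 1-strongly convex in the Euclidean norm
  and varies by at most half the squared diameter on \<open>K\<close> (for example half the squared distance to a
  point of \<open>K\<close>), and with the step size tuned to horizon \<open>T\<close> and vectors of norm at most \<open>G\<close>.
  These are the parameters for which its regret is at most \<open>diameter K * G * sqrt (2 * T)\<close>.\<close>

definition is_RFTL ::
  "(real ^ 'n) set \<Rightarrow> nat \<Rightarrow> real \<Rightarrow> ((real ^ 'n) list \<Rightarrow> real ^ 'n) \<Rightarrow> bool" where
  "is_RFTL K T G A \<longleftrightarrow>
     (\<exists>\<Phi>. strongly_convex_on K \<Phi> \<and>
          (\<forall>x \<in> K. \<forall>z \<in> K. \<Phi> x - \<Phi> z \<le> (diameter K)\<^sup>2 / 2) \<and>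
          follows_regularized_leader K \<Phi> (diameter K / (G * sqrt (2 * real T))) A)"

text \<open>The \<open>\<sigma>\<close>-algebra generated by the random function \<open>f\<close> on the cube and the random vectors
  \<open>p\<close> and \<open>u\<close>.\<close>

definition information ::
  "'w measure \<Rightarrow> ('w \<Rightarrow> real ^ 'n \<Rightarrow> real) \<Rightarrow> ('w \<Rightarrow> real ^ 'n) \<Rightarrow> ('w \<Rightarrow> real ^ 'n) \<Rightarrow> 'w measure" where
  "information M f p u = sigma (space M)
     ((\<Union>x \<in> cbox 0 1. {(\<lambda>\<omega>. f \<omega> x) -` A \<inter> space M | A. A \<in> sets borel}) \<union>
      {p -` A \<inter> space M | A. A \<in> sets borel} \<union>
      {u -` A \<inter> space M | A. A \<in> sets borel})"

text \<open>\<open>d\<close> is an unbiased estimator of the gradient of \<open>f\<close> at \<open>p\<close>, drawn independently of \<open>u\<close>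
  in the sense that conditioning on \<open>u\<close> as well does not change its mean. Conditioning on \<open>p\<close>
  alone would allow the noise to be correlated with the vector \<open>u\<close> selected by the linear optimizer
  that \<open>d\<close> is passed to; for a random \<open>f\<close> the gradient at \<open>p\<close> is not even a function of \<open>p\<close>.\<close>

definition unbiased_gradient_estimator ::
  "'w measure \<Rightarrow> ('w \<Rightarrow> real ^ 'n \<Rightarrow> real) \<Rightarrow> ('w \<Rightarrow> real ^ 'n) \<Rightarrow> ('w \<Rightarrow> real ^ 'n) \<Rightarrow> ('w \<Rightarrow> real ^ 'n) \<Rightarrow> bool"
where
  "unbiased_gradient_estimator M f p u d \<longleftrightarrow>
     integrable M d \<and>
     (\<forall>k. AE \<omega> in M. real_cond_exp M (information M f p u) (\<lambda>\<omega>. d \<omega> $ k) \<omega>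
                      = cube_gradient (f \<omega>) (p \<omega>) $ k)"

text \<open>A run of NMMFW: \<open>E i\<close> is the \<open>i\<close>-th linear optimizer, \<open>s i t\<close> the vector it picks in step
  \<open>t\<close>, \<open>g i t\<close> the estimator passed to it in step \<open>t\<close>; the vector played in step \<open>t\<close> is
  \<open>y L t\<close>.\<close>

definition NMMFW_run ::
  "'w measure \<Rightarrow> (real ^ 'n) set \<Rightarrow> nat \<Rightarrow> real \<Rightarrow> nat \<Rightarrow> (nat \<Rightarrow> 'w \<Rightarrow> real ^ 'n \<Rightarrow> real) \<Rightarrow>
   (nat \<Rightarrow> ('w, 'n) olo) \<Rightarrow> (nat \<Rightarrow> nat \<Rightarrow> 'w \<Rightarrow> real ^ 'n) \<Rightarrow> (nat \<Rightarrow> nat \<Rightarrow> 'w \<Rightarrow> real ^ 'n) \<Rightarrow>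
   (nat \<Rightarrow> nat \<Rightarrow> 'w \<Rightarrow> real ^ 'n) \<Rightarrow> bool"
where
  "NMMFW_run M K L \<epsilon> T F E s y g \<longleftrightarrow>
     (\<forall>i \<in> {1..L}. \<forall>\<omega> \<in> space M. \<forall>ds. E i \<omega> ds \<in> K) \<and>
     (\<forall>t \<in> {1..T}.
        y 0 t \<in> borel_measurable M \<and>
        (\<forall>\<omega> \<in> space M. is_arg_min infnorm (\<lambda>x. x \<in> K) (y 0 t \<omega>)) \<and>
        (\<forall>i \<in> {1..L}.
           s i t \<in> borel_measurable M \<and>
           (\<forall>\<omega> \<in> space M.
              s i t \<omega> = E i \<omega> (map (\<lambda>\<tau>. g i \<tau> \<omega>) [1..<t]) \<and>
              y i t \<omega> = (1 - \<epsilon>) *\<^sub>R y (i - 1) t \<omega> + \<epsilon> *\<^sub>R s i t \<omega>) \<and>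
           unbiased_gradient_estimator M (F t) (y (i - 1) t) (s i t) (g i t)))"

definition estimator_norms ::
  "'w measure \<Rightarrow> nat \<Rightarrow> nat \<Rightarrow> (nat \<Rightarrow> nat \<Rightarrow> 'w \<Rightarrow> real ^ 'n) \<Rightarrow> real set" where
  "estimator_norms M L T g = {norm (g i t \<omega>) | i t \<omega>. i \<in> {1..L} \<and> t \<in> {1..T} \<and> \<omega> \<in> space M}"

text \<open>The largest norm over all indices and all outcomes; \<open>0\<close> is inserted only to cover \<open>L = 0\<close>.\<close>

definition max_estimator_norm ::
  "'w measure \<Rightarrow> nat \<Rightarrow> nat \<Rightarrow> (nat \<Rightarrow> nat \<Rightarrow> 'w \<Rightarrow> real ^ 'n) \<Rightarrow> real" where
  "max_estimator_norm M L T g = Sup (insert 0 (estimator_norms M L T g))"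

end

theory Submission
  imports Defs
begin

text \<open>
  DR-submodularity makes \<open>F\<close> concave along directions of constant sign, so its gradient at \<open>y\<close>
  satisfies \<open>\<langle>o - y, \<nabla>F y\<rangle> \<ge> F (o \<or> y) + F (o \<and> y) - 2 F y\<close>, and non-negativity gives
  \<open>F (o \<or> y) \<ge> (1 - \<parallel>y\<parallel>) F o\<close> in the maximum norm. Each averaging step multiplies
  \<open>1 - \<parallel>y\<parallel>\<close> by at least \<open>1 - \<epsilon>\<close>. Combined with the quadratic lower bound from
  smoothness, the \<open>i\<close>-th averaging step therefore turns the total expected reward \<open>a\<close> into at least
  \<open>(1 - 2\<epsilon>) a + \<epsilon> (1 - \<epsilon>)^(i-1) (1 - min \<parallel>x\<parallel>) OPT\<close>, up to the smoothness error and \<open>\<epsilon>\<close>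
  times the regret of the \<open>i\<close>-th linear optimizer; unbiasedness lets the estimators replace the
  gradients there. Unrolling gives the first bound because \<open>1 - \<epsilon> \<ge> (1 - 2\<epsilon>) (1 + \<epsilon>)\<close>.
  The second one uses the be-the-leader analysis of Regularized-Follow-the-Leader, and is trivial
  for \<open>\<epsilon> \<ge> 1/12\<close>.
\<close>

section \<open>Smooth DR-submodular functions on the cube\<close>

lemma has_derivative_cube_gradient:
  fixes f :: "real ^ 'n \<Rightarrow> real"
  assumes "f differentiable_on cbox 0 1" and x: "x \<in> cbox 0 1"
  shows "(f has_derivative (\<lambda>h. cube_gradient f x \<bullet> h)) (at x within cbox 0 1)"
proof -
  obtain f' where f': "(f has_derivative f') (at x within cbox 0 1)"
    using assms unfolding differentiable_on_def differentiable_def by blast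
  \<comment> \<open>Riesz representation: a linear functional is the inner product with its adjoint
    evaluated at 1. This is the witness for the \<open>THE\<close>.\<close>
  have "f' = (\<lambda>h. adjoint f' 1 \<bullet> h)"
    using adjoint_works[OF has_derivative_linear[OF f'], of _ 1] by (auto simp: inner_commute)
  with f' have v: "(f has_derivative (\<lambda>h. adjoint f' 1 \<bullet> h)) (at x within cbox 0 1)" by simp
  show ?thesis
    unfolding cube_gradient_def
  proof (rule theI[of _ "adjoint f' 1"])
    \<comment> \<open>Uniqueness holds even at boundary points because the cube is nondegenerate in
      every coordinate direction.\<close>
    fix w assume "(f has_derivative (\<lambda>h. w \<bullet> h)) (at x within cbox 0 1)"
    then have "(\<lambda>h. w \<bullet> h) = (\<lambda>h. adjoint f' 1 \<bullet> h)"
      by (intro frechet_derivative_unique_within_closed_interval[OF _ x _ v])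
        (auto simp: Basis_vec_def inner_axis)
    then show "w = adjoint f' 1"
      by (metis vector_eq_rdot)
  qed (rule v)
qed

lemma cube_segment:
  fixes x h :: "real ^ 'n"
  assumes "x \<in> cbox 0 1" "x + h \<in> cbox 0 1" "\<tau> \<in> {0..1}"
  shows "x + \<tau> *\<^sub>R h \<in> cbox 0 1"
proof -
  have "(1 - \<tau>) *\<^sub>R x + \<tau> *\<^sub>R (x + h) \<in> cbox 0 1"
    using assms by (intro convexD[OF convex_box(1)]) auto
  then show ?thesis by (simp add: algebra_simps)
qed

lemma has_real_derivative_along_segment:
  fixes f :: "real ^ 'n \<Rightarrow> real"
  assumes f: "\<And>z. z \<in> cbox 0 1 \<Longrightarrow> (f has_derivative (\<lambda>h. v z \<bullet> h)) (at z within cbox 0 1)"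
    and x: "x \<in> cbox 0 1" "x + h \<in> cbox 0 1" and \<tau>: "\<tau> \<in> {0..1}"
  shows "((\<lambda>\<tau>. f (x + \<tau> *\<^sub>R h)) has_real_derivative v (x + \<tau> *\<^sub>R h) \<bullet> h) (at \<tau> within {0..1})"
proof -
  have "((f \<circ> (\<lambda>\<tau>. x + \<tau> *\<^sub>R h)) has_derivative
      (\<lambda>k. v (x + \<tau> *\<^sub>R h) \<bullet> k) \<circ> (\<lambda>k. k *\<^sub>R h)) (at \<tau> within {0..1})"
  proof (rule diff_chain_within)
    show "((\<lambda>\<tau>. x + \<tau> *\<^sub>R h) has_derivative (\<lambda>k. k *\<^sub>R h)) (at \<tau> within {0..1})"
      by (auto intro!: derivative_eq_intros)
    have "(f has_derivative (\<lambda>k. v (x + \<tau> *\<^sub>R h) \<bullet> k)) (at (x + \<tau> *\<^sub>R h) within cbox 0 1)"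
      using cube_segment[OF x \<tau>] by (rule f)
    then show "(f has_derivative (\<lambda>k. v (x + \<tau> *\<^sub>R h) \<bullet> k))
      (at (x + \<tau> *\<^sub>R h) within (\<lambda>\<tau>. x + \<tau> *\<^sub>R h) ` {0..1})"
      by (rule has_derivative_subset) (use cube_segment[OF x] in auto)
  qed
  then show ?thesis
    unfolding has_field_derivative_def comp_def by (simp add: mult.commute[of _ "_ \<bullet> _"])
qed

text \<open>Stated for an arbitrary gradient field \<open>v\<close> so that it also applies to
  \<open>- f\<close>, which yields the matching upper bound. Along the segment, Cauchy-Schwarz and
  the Lipschitz condition bound the drop of the slope below its initial value.\<close>

lemma quadratic_lower_bound:
  fixes f :: "real ^ 'n \<Rightarrow> real"
  assumes f: "\<And>z. z \<in> cbox 0 1 \<Longrightarrow> (f has_derivative (\<lambda>h. v z \<bullet> h)) (at z within cbox 0 1)"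
    and lip: "\<And>x y. x \<in> cbox 0 1 \<Longrightarrow> y \<in> cbox 0 1 \<Longrightarrow> norm (v x - v y) \<le> \<beta> * norm (x - y)"
    and x: "x \<in> cbox 0 1" "x + h \<in> cbox 0 1"
  shows "f x + v x \<bullet> h - \<beta> / 2 * (norm h)\<^sup>2 \<le> f (x + h)"
proof -
  \<comment> \<open>The deviation from the tangent plus the quadratic that compensates the largest
    possible drop of the slope; \<open>\<psi>\<close> is therefore nondecreasing, and comparing its
    values at 0 and 1 is the claim.\<close>
  define \<psi> where "\<psi> \<tau> = f (x + \<tau> *\<^sub>R h) - \<tau> * (v x \<bullet> h) + \<beta> / 2 * \<tau>\<^sup>2 * (norm h)\<^sup>2" for \<tau>
  have d: "(\<psi> has_real_derivative v (x + \<tau> *\<^sub>R h) \<bullet> h - v x \<bullet> h + \<beta> * \<tau> * (norm h)\<^sup>2) (at \<tau> within {0..1})"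
    if "\<tau> \<in> {0..1}" for \<tau>
    unfolding \<psi>_def
    by (rule derivative_eq_intros has_real_derivative_along_segment[OF f x that] refl | assumption)+
      (simp add: algebra_simps)
  have "\<psi> 0 \<le> \<psi> 1"
  proof (rule DERIV_nonneg_imp_increasing_open[of 0 1 \<psi>])
    fix \<tau> :: real assume \<tau>: "0 < \<tau>" "\<tau> < 1"
    have "\<bar>(v (x + \<tau> *\<^sub>R h) - v x) \<bullet> h\<bar> \<le> norm (v (x + \<tau> *\<^sub>R h) - v x) * norm h"
      by (rule Cauchy_Schwarz_ineq2)
    also have "\<dots> \<le> (\<beta> * norm (\<tau> *\<^sub>R h)) * norm h"
      using lip[OF cube_segment[OF x, of \<tau>] x(1)] \<tau> by (intro mult_right_mono) auto
    also have "\<dots> = \<beta> * \<tau> * (norm h)\<^sup>2"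
      using \<tau> by (simp add: power2_eq_square)
    finally have "0 \<le> v (x + \<tau> *\<^sub>R h) \<bullet> h - v x \<bullet> h + \<beta> * \<tau> * (norm h)\<^sup>2"
      by (auto simp: inner_diff_left)
    moreover have "at \<tau> within {0..1} = at \<tau>"
      using \<tau> by (intro at_within_interior) auto
    ultimately show "\<exists>y. (\<psi> has_real_derivative y) (at \<tau>) \<and> y \<ge> 0"
      using d[of \<tau>] \<tau> by auto
  next
    show "continuous_on {0..1} \<psi>"
      using d by (intro DERIV_continuous_on)
  qed simp
  then show ?thesis by (simp add: \<psi>_def)
qed

lemma smooth_on_cube_bounds:
  fixes f :: "real ^ 'n \<Rightarrow> real"
  assumes s: "smooth_on_cube \<beta> f" and x: "x \<in> cbox 0 1" "z \<in> cbox 0 1"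
  shows "f x + cube_gradient f x \<bullet> (z - x) - \<beta> / 2 * (norm (z - x))\<^sup>2 \<le> f z"
    and "f z \<le> f x + cube_gradient f x \<bullet> (z - x) + \<beta> / 2 * (norm (z - x))\<^sup>2"
proof -
  have d: "(f has_derivative (\<lambda>h. cube_gradient f y \<bullet> h)) (at y within cbox 0 1)" if "y \<in> cbox 0 1" for y
    using s that has_derivative_cube_gradient unfolding smooth_on_cube_def by blast
  have lip: "norm (cube_gradient f a - cube_gradient f b) \<le> \<beta> * norm (a - b)"
    if "a \<in> cbox 0 1" "b \<in> cbox 0 1" for a b
    using s that unfolding smooth_on_cube_def by blast
  show "f x + cube_gradient f x \<bullet> (z - x) - \<beta> / 2 * (norm (z - x))\<^sup>2 \<le> f z"
    using quadratic_lower_bound[of f "cube_gradient f" \<beta> x "z - x", OF d lip] x by simp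
  have "((\<lambda>x. - f x) has_derivative (\<lambda>h. - cube_gradient f y \<bullet> h)) (at y within cbox 0 1)"
    if "y \<in> cbox 0 1" for y
    using has_derivative_minus[OF d[OF that]] by simp
  then show "f z \<le> f x + cube_gradient f x \<bullet> (z - x) + \<beta> / 2 * (norm (z - x))\<^sup>2"
    using quadratic_lower_bound[of "\<lambda>x. - f x" "\<lambda>x. - cube_gradient f x" \<beta> x "z - x"] x lip
    by (simp add: norm_minus_commute)
qed

lemma smooth_on_cube_nonneg:
  fixes f :: "real ^ 'n \<Rightarrow> real"
  assumes "smooth_on_cube \<beta> f"
  shows "0 \<le> \<beta>"
proof -
  have "norm (cube_gradient f 0 - cube_gradient f 1) \<le> \<beta> * norm (0 - 1 :: real ^ 'n)"
    using assms unfolding smooth_on_cube_def by (simp add: mem_box_cart del: diff_0)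
  then have "0 \<le> \<beta> * norm (0 - 1 :: real ^ 'n)" by (rule order_trans[OF norm_ge_zero])
  then show ?thesis by (auto simp: zero_le_mult_iff)
qed

section \<open>What DR-submodularity says about increments, tangents and joins\<close>

lemma DR_submodular_increments:
  fixes f :: "real ^ 'n \<Rightarrow> real"
  assumes dr: "DR_submodular f" and a: "a \<in> cbox 0 1" and b: "b \<in> cbox 0 1" and ab: "a \<le> b"
    and w: "0 \<le> w" and bw: "b + w \<in> cbox 0 1"
  shows "f (b + w) - f b \<le> f (a + w) - f a"
proof -
  \<comment> \<open>The definition only treats single-coordinate increments, so \<open>w\<close> is
    added one coordinate at a time: \<open>r S\<close> is its restriction to the coordinates in
    \<open>S\<close>.\<close>
  define r where "r S = (\<chi> i. if i \<in> S then w $ i else 0)" for S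
  have r: "c + r S \<in> cbox 0 1" if "c \<in> cbox 0 1" "c \<le> b" for S c
    using that bw w unfolding mem_box_cart r_def less_eq_vec_def
    by auto (smt (verit))+
  have "f (b + r S) - f b \<le> f (a + r S) - f a" if "finite S" for S
    using that
  proof induction
    case empty
    have "r {} = 0" by (simp add: r_def vec_eq_iff)
    then show ?case by simp
  next
    case (insert i S)
    have eq: "c + r (insert i S) = (c + r S) + (w $ i) *\<^sub>R axis i 1" for c
      using insert.hyps by (auto simp: r_def vec_eq_iff axis_def)
    have "f ((b + r S) + (w $ i) *\<^sub>R axis i 1) - f (b + r S)
        \<le> f ((a + r S) + (w $ i) *\<^sub>R axis i 1) - f (a + r S)"
    \<comment> \<open>The definition quantifies over \<open>k > 0\<close>; a zero coordinate leaves
      both sides unchanged.\<close>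
    proof (cases "w $ i = 0")
      case False
      then have "0 < w $ i" using w by (auto simp: less_eq_vec_def order.strict_iff_order)
      moreover have "a + r S \<le> b + r S" using ab by (simp add: less_eq_vec_def)
      ultimately show ?thesis
        using dr r[OF a ab] r[OF b order_refl] eq unfolding DR_submodular_def by metis
    qed simp
    then show ?case using insert.IH unfolding eq by linarith
  qed
  from this[of UNIV] show ?thesis by (simp add: r_def)
qed

text \<open>The increment along \<open>h\<close> is at most \<open>N\<close> times the increment along \<open>h / N\<close>, which
  tends to the directional derivative.\<close>

lemma DR_submodular_tangent:
  fixes f :: "real ^ 'n \<Rightarrow> real"
  assumes dr: "DR_submodular f" and df: "f differentiable_on cbox 0 1"
    and y: "y \<in> cbox 0 1" "y + h \<in> cbox 0 1" and h: "0 \<le> h \<or> h \<le> 0"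
  shows "f (y + h) - f y \<le> cube_gradient f y \<bullet> h"
proof -
  define \<phi> where "\<phi> \<tau> = f (y + \<tau> *\<^sub>R h)" for \<tau>
  have seg: "y + \<tau> *\<^sub>R h \<in> cbox 0 1" if "0 \<le> \<tau>" "\<tau> \<le> 1" for \<tau>
    using cube_segment[OF y] that by simp
  \<comment> \<open>Along a nonnegative direction this compares the base points \<open>y\<close> and
    \<open>y + \<tau> h\<close>. Along a nonpositive one the path is read backwards: the nonnegative
    increment \<open>- \<delta> h\<close> is added to \<open>y + (\<tau> + \<delta>) h\<close> and
    to the larger point \<open>y + \<delta> h\<close>.\<close>
  have incr: "\<phi> (\<tau> + \<delta>) - \<phi> \<tau> \<le> \<phi> \<delta> - \<phi> 0" if \<tau>: "0 \<le> \<tau>" "0 \<le> \<delta>" "\<tau> + \<delta> \<le> 1" for \<tau> \<delta>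
    using h
  proof
    assume h: "0 \<le> h"
    show ?thesis
      using DR_submodular_increments[OF dr, of y "y + \<tau> *\<^sub>R h" "\<delta> *\<^sub>R h"] y h \<tau> seg[of \<tau>] seg[of "\<tau> + \<delta>"]
      by (auto simp: \<phi>_def less_eq_vec_def algebra_simps)
  next
    assume h: "h \<le> 0"
    have le: "y + (\<tau> + \<delta>) *\<^sub>R h \<le> y + \<delta> *\<^sub>R h"
      using h \<tau> by (auto simp: less_eq_vec_def algebra_simps mult_nonneg_nonpos)
    have "0 \<le> - \<delta> *\<^sub>R h" using h \<tau> by (auto simp: less_eq_vec_def mult_nonneg_nonpos)
    from DR_submodular_increments[OF dr _ _ le this] show ?thesis
      using seg[of "\<tau> + \<delta>"] seg[of \<delta>] y \<tau> by (simp add: \<phi>_def algebra_simps)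
  qed
  have tele: "\<phi> 1 - \<phi> 0 \<le> (\<phi> (1 / real (Suc n)) - \<phi> 0) / (1 / real (Suc n) - 0)" for n
  proof -
    let ?N = "real (Suc n)"
    have "\<phi> (real k / ?N) - \<phi> 0 \<le> real k * (\<phi> (1 / ?N) - \<phi> 0)" if "k \<le> Suc n" for k
      using that
    proof (induction k)
      case (Suc k)
      have "\<phi> (real k / ?N + 1 / ?N) - \<phi> (real k / ?N) \<le> \<phi> (1 / ?N) - \<phi> 0"
        using Suc.prems by (intro incr) (auto simp: field_simps)
      then show ?case using Suc by (auto simp: algebra_simps add_divide_distrib)
    qed simp
    from this[of "Suc n"] show ?thesis by (simp add: mult.commute)
  qed
  have "(\<phi> has_real_derivative cube_gradient f y \<bullet> h) (at 0 within {0..1})"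
    using has_real_derivative_along_segment[OF has_derivative_cube_gradient[OF df] y, of 0]
    by (simp add: \<phi>_def[abs_def])
  then have lim: "((\<lambda>\<tau>. (\<phi> \<tau> - \<phi> 0) / (\<tau> - 0)) \<longlongrightarrow> cube_gradient f y \<bullet> h) (at 0 within {0..1})"
    by (simp add: has_field_derivative_iff)
  \<comment> \<open>The step lengths 1/(n+1) tend to 0 inside [0,1], so the one-sided derivative
    suffices when \<open>y\<close> lies on the boundary.\<close>
  have "filterlim (\<lambda>n. 1 / real (Suc n)) (at 0 within {0..1}) sequentially"
    unfolding filterlim_at using LIMSEQ_inverse_real_of_nat
    by (auto simp: field_simps intro!: eventuallyI)
  from filterlim_compose[OF lim this]
  have "(\<lambda>n. (\<phi> (1 / real (Suc n)) - \<phi> 0) / (1 / real (Suc n) - 0)) \<longlonglongrightarrow> cube_gradient f y \<bullet> h" .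
  then have "\<phi> 1 - \<phi> 0 \<le> cube_gradient f y \<bullet> h"
    using tele by (intro LIMSEQ_le_const) auto
  then show ?thesis by (simp add: \<phi>_def)
qed

lemma infnorm_cube_le_1: "infnorm x \<le> 1" if "x \<in> cbox 0 1" for x :: "real ^ 'n"
  using that unfolding infnorm_cart by (intro cSup_least) (auto simp: mem_box_cart)

text \<open>With \<open>p\<close> the join and \<open>c = infnorm y\<close>, the point
  \<open>q\<close> is chosen so that \<open>p\<close> equals \<open>(1 - c) x + c q\<close> while
  \<open>q\<close> stays in the cube. Concavity along the nonnegative direction \<open>p - x\<close>
  and \<open>0 \<le> f q\<close> then give the bound.\<close>

lemma DR_submodular_join_ge:
  fixes f :: "real ^ 'n \<Rightarrow> real"
  assumes dr: "DR_submodular f" and df: "f differentiable_on cbox 0 1"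
    and nonneg: "\<And>x. x \<in> cbox 0 1 \<Longrightarrow> 0 \<le> f x"
    and x: "x \<in> cbox 0 1" and y: "y \<in> cbox 0 1"
  shows "(1 - infnorm y) * f x \<le> f (\<chi> j. max (x $ j) (y $ j))"
proof -
  define p where "p = (\<chi> j. max (x $ j) (y $ j))"
  define c where "c = infnorm y"
  have p: "p \<in> cbox 0 1" using x y by (auto simp: p_def mem_box_cart max_def)
  have yc: "\<bar>y $ j\<bar> \<le> c" for j
    using component_le_infnorm_cart[of y j] by (simp add: c_def)
  \<comment> \<open>\<open>q\<close> divides by \<open>c\<close>, hence the separate case
    \<open>c = 0\<close>, where the join is \<open>x\<close> itself. For \<open>c = 1\<close> the
    left side vanishes.\<close>
  consider "c = 0" | "c = 1" | "0 < c" "c < 1"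
    using infnorm_pos_le[of y] infnorm_cube_le_1[OF y] unfolding c_def by linarith
  then have "(1 - c) * f x \<le> f p"
  proof cases
    case 1
    then have "y = 0" by (simp add: c_def infnorm_eq_0)
    then have "p = x" using x by (auto simp: p_def vec_eq_iff mem_box_cart max_def order.antisym)
    then show ?thesis using 1 by simp
  next
    case 2
    then show ?thesis using nonneg[OF p] by simp
  next
    case 3
    define v where "v = p - x"
    have v: "0 \<le> v" by (simp add: v_def p_def less_eq_vec_def)
    define q where "q = p + ((1 - c) / c) *\<^sub>R v"
    have qj: "q $ j = x $ j + v $ j / c" for j
      using 3 by (simp add: q_def v_def field_simps)
    have q: "q \<in> cbox 0 1"
      unfolding mem_box_cart
    proof
      fix j
      \<comment> \<open>This is exactly the upper bound \<open>q $ j \<le> 1\<close>. Where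
        \<open>v $ j\<close> is not 0, it equals \<open>y $ j - x $ j\<close>, which is at most
        \<open>c - c * x $ j\<close>.\<close>
      have "v $ j \<le> c * (1 - x $ j)"
      proof (cases "y $ j \<le> x $ j")
        case True
        then show ?thesis using 3 x by (simp add: v_def p_def max_def mem_box_cart)
      next
        case False
        have "c * x $ j \<le> 1 * x $ j" using 3 x by (intro mult_right_mono) (auto simp: mem_box_cart)
        with False yc[of j] show ?thesis by (simp add: v_def p_def max_def algebra_simps)
      qed
      then have "v $ j / c \<le> 1 - x $ j" using 3 by (simp add: divide_le_eq mult.commute)
      moreover have "0 \<le> v $ j / c" using v 3 by (simp add: less_eq_vec_def)
      ultimately show "0 $ j \<le> q $ j \<and> q $ j \<le> 1 $ j" using x by (auto simp: qj mem_box_cart)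
    qed
    \<comment> \<open>Two tangent inequalities at \<open>p\<close>, backwards to \<open>x\<close>
      and forwards to \<open>q\<close>; eliminating the directional derivative along
      \<open>v\<close> leaves the concavity inequality at \<open>p\<close>.\<close>
    have 1: "f (p + - v) - f p \<le> cube_gradient f p \<bullet> - v"
      using x v by (intro DR_submodular_tangent[OF dr df p]) (auto simp: v_def)
    have "f q - f p \<le> cube_gradient f p \<bullet> (((1 - c) / c) *\<^sub>R v)"
      unfolding q_def using q v 3
      by (intro DR_submodular_tangent[OF dr df p]) (auto simp: q_def less_eq_vec_def)
    also have "\<dots> = (1 - c) / c * (cube_gradient f p \<bullet> v)" by simp
    also have "\<dots> \<le> (1 - c) / c * (f p - f x)"
      using 1 3 by (intro mult_left_mono) (auto simp: v_def inner_diff_right)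
    finally have "c * (f q - f p) \<le> (1 - c) * (f p - f x)"
      using 3 by (simp add: pos_le_divide_eq mult.commute)
    moreover have "0 \<le> c * f q" using 3 nonneg[OF q] by simp
    ultimately show ?thesis by (simp add: algebra_simps)
  qed
  then show ?thesis by (simp add: p_def c_def)
qed

text \<open>The direction \<open>x - y\<close> may have mixed signs, where concavity can fail. Its
  positive part leads from \<open>y\<close> to the join and its negative part to the meet, and the
  tangent inequality applies to each; the value at the meet is dropped by non-negativity.\<close>

lemma DR_submodular_gradient_towards:
  fixes f :: "real ^ 'n \<Rightarrow> real"
  assumes dr: "DR_submodular f" and df: "f differentiable_on cbox 0 1"
    and nonneg: "\<And>x. x \<in> cbox 0 1 \<Longrightarrow> 0 \<le> f x"
    and x: "x \<in> cbox 0 1" and y: "y \<in> cbox 0 1"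
  shows "(1 - infnorm y) * f x - 2 * f y \<le> cube_gradient f y \<bullet> (x - y)"
proof -
  define p where "p = (\<chi> j. max (x $ j) (y $ j))"
  define q where "q = (\<chi> j. min (x $ j) (y $ j))"
  have p: "p \<in> cbox 0 1" and q: "q \<in> cbox 0 1"
    using x y by (auto simp: p_def q_def mem_box_cart max_def min_def)
  have "f (y + (p - y)) - f y \<le> cube_gradient f y \<bullet> (p - y)"
    using p by (intro DR_submodular_tangent[OF dr df y]) (auto simp: p_def less_eq_vec_def)
  moreover have "f (y + (q - y)) - f y \<le> cube_gradient f y \<bullet> (q - y)"
    using q by (intro DR_submodular_tangent[OF dr df y]) (auto simp: q_def less_eq_vec_def)
  moreover have "x - y = (p - y) + (q - y)"
    by (auto simp: p_def q_def vec_eq_iff max_def min_def)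
  then have "cube_gradient f y \<bullet> (x - y) = cube_gradient f y \<bullet> (p - y) + cube_gradient f y \<bullet> (q - y)"
    by (simp only: inner_add_right)
  moreover have "(1 - infnorm y) * f x \<le> f p"
    unfolding p_def by (rule DR_submodular_join_ge[OF dr df nonneg x y])
  ultimately show ?thesis using nonneg[OF q] by simp
qed

text \<open>The move \<open>z - y\<close> is \<open>\<epsilon>\<close> times
  \<open>(x - y) + (s - x)\<close>. The first summand gains through the preceding lemma, whose
  \<open>- 2 * f y\<close> produces the factor \<open>1 - 2 * \<epsilon>\<close>; the second is the
  term that the regret of the linear optimizer controls.\<close>

lemma frank_wolfe_step:
  fixes f :: "real ^ 'n \<Rightarrow> real"
  assumes dr: "DR_submodular f" and sm: "smooth_on_cube \<beta> f"
    and nonneg: "\<And>x. x \<in> cbox 0 1 \<Longrightarrow> 0 \<le> f x"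
    and x: "x \<in> cbox 0 1" and y: "y \<in> cbox 0 1" and s: "s \<in> cbox 0 1"
    and \<epsilon>: "0 \<le> \<epsilon>" "\<epsilon> \<le> 1" and D: "norm (s - y) \<le> D"
  shows "(1 - 2 * \<epsilon>) * f y + \<epsilon> * ((1 - infnorm y) * f x) + \<epsilon> * ((s - x) \<bullet> cube_gradient f y)
      - 0.5 * \<epsilon>\<^sup>2 * \<beta> * D\<^sup>2 \<le> f ((1 - \<epsilon>) *\<^sub>R y + \<epsilon> *\<^sub>R s)"
proof -
  define z where "z = (1 - \<epsilon>) *\<^sub>R y + \<epsilon> *\<^sub>R s"
  have z: "z \<in> cbox 0 1" unfolding z_def using y s \<epsilon> by (intro convexD[OF convex_box(1)]) auto
  have zy: "z - y = \<epsilon> *\<^sub>R (s - y)" by (simp add: z_def algebra_simps)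
  have "f y + cube_gradient f y \<bullet> (z - y) - \<beta> / 2 * (norm (z - y))\<^sup>2 \<le> f z"
    by (rule smooth_on_cube_bounds[OF sm y z])
  moreover have "\<beta> / 2 * (norm (z - y))\<^sup>2 \<le> \<beta> / 2 * (\<epsilon> * D)\<^sup>2"
    using smooth_on_cube_nonneg[OF sm] \<epsilon> D unfolding zy
    by (intro mult_left_mono power_mono) (auto intro!: mult_left_mono)
  moreover have "\<epsilon> * ((1 - infnorm y) * f x - 2 * f y) \<le> \<epsilon> * (cube_gradient f y \<bullet> (x - y))"
    using sm \<epsilon> unfolding smooth_on_cube_def
    by (intro mult_left_mono DR_submodular_gradient_towards[OF dr _ nonneg x y]) auto
  moreover have "cube_gradient f y \<bullet> (z - y) = \<epsilon> * (cube_gradient f y \<bullet> (x - y)) + \<epsilon> * ((s - x) \<bullet> cube_gradient f y)"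
    by (simp add: zy inner_diff_right inner_diff_left inner_commute algebra_simps)
  ultimately show ?thesis unfolding z_def[symmetric] by (simp add: algebra_simps power_mult_distrib)
qed

section \<open>Regret of Regularized-Follow-the-Leader\<close>

text \<open>The maximizer is compared with the point at weight \<open>v\<close> on the segment
  towards \<open>z\<close>. Strong convexity makes the comparison strict by a multiple of
  \<open>v\<close>; dividing by \<open>v\<close> and letting it tend to 0 gives the quadratic
  gap.\<close>

lemma strongly_convex_arg_max_gap:
  fixes K :: "(real ^ 'n) set"
  assumes K: "convex K" and \<Phi>: "strongly_convex_on K \<Phi>"
    and x: "is_arg_max (\<lambda>z. c \<bullet> z - \<Phi> z) (\<lambda>z. z \<in> K) x" and z: "z \<in> K"
  shows "(c \<bullet> z - \<Phi> z) + (norm (x - z))\<^sup>2 / 2 \<le> c \<bullet> x - \<Phi> x"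
proof -
  have xK: "x \<in> K" and mx: "\<And>w. w \<in> K \<Longrightarrow> c \<bullet> w - \<Phi> w \<le> c \<bullet> x - \<Phi> x"
    using x by (auto simp: is_arg_max_linorder)
  have ineq: "(c \<bullet> z - \<Phi> z) + (1 - v) * ((norm (x - z))\<^sup>2 / 2) \<le> c \<bullet> x - \<Phi> x"
    if v: "0 < v" "v < 1" for v
  proof -
    define w where "w = (1 - v) *\<^sub>R x + v *\<^sub>R z"
    have "w \<in> K" unfolding w_def using v xK z by (intro convexD[OF K]) auto
    then have 1: "c \<bullet> w - \<Phi> w \<le> c \<bullet> x - \<Phi> x" by (rule mx)
    have "\<Phi> w \<le> (1 - v) * \<Phi> x + v * \<Phi> z - (1 - v) * v / 2 * (norm (x - z))\<^sup>2"
      using \<Phi> xK z v unfolding strongly_convex_on_def w_def by auto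
    with 1 have "v * ((c \<bullet> z - \<Phi> z) + (1 - v) * ((norm (x - z))\<^sup>2 / 2)) \<le> v * (c \<bullet> x - \<Phi> x)"
      by (simp add: w_def inner_add_right algebra_simps)
    then show ?thesis using v by simp
  qed
  have "((\<lambda>v. (c \<bullet> z - \<Phi> z) + (1 - v) * ((norm (x - z))\<^sup>2 / 2)) \<longlongrightarrow>
      (c \<bullet> z - \<Phi> z) + (1 - 0) * ((norm (x - z))\<^sup>2 / 2)) (at_right 0)"
    by (intro tendsto_intros)
  moreover have "\<forall>\<^sub>F v in at_right 0. (c \<bullet> z - \<Phi> z) + (1 - v) * ((norm (x - z))\<^sup>2 / 2) \<le> c \<bullet> x - \<Phi> x"
    using ineq by (auto simp: eventually_at_right_field intro!: exI[of _ 1])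
  ultimately have "(c \<bullet> z - \<Phi> z) + (1 - 0) * ((norm (x - z))\<^sup>2 / 2) \<le> c \<bullet> x - \<Phi> x"
    by (intro tendsto_upperbound) auto
  then show ?thesis by simp
qed

text \<open>Adding the gap inequalities of the two problems, each evaluated at the maximizer of the
  other, cancels \<open>c\<close> and \<open>\<Phi>\<close>. What remains bounds the squared
  distance by \<open>\<eta>\<close> times the inner product, and Cauchy-Schwarz does the
  rest.\<close>

lemma RFTL_stability:
  fixes K :: "(real ^ 'n) set"
  assumes K: "convex K" and \<Phi>: "strongly_convex_on K \<Phi>" and \<eta>: "0 < \<eta>"
    and x: "is_arg_max (\<lambda>z. c \<bullet> z - \<Phi> z) (\<lambda>z. z \<in> K) x"
    and x': "is_arg_max (\<lambda>z. (c + \<eta> *\<^sub>R d) \<bullet> z - \<Phi> z) (\<lambda>z. z \<in> K) x'"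
  shows "(x' - x) \<bullet> d \<le> \<eta> * (norm d)\<^sup>2"
proof -
  have mem: "x \<in> K" "x' \<in> K" using x x' by (auto simp: is_arg_max_def)
  have "(norm (x' - x))\<^sup>2 \<le> \<eta> * ((x' - x) \<bullet> d)"
    using strongly_convex_arg_max_gap[OF K \<Phi> x mem(2)] strongly_convex_arg_max_gap[OF K \<Phi> x' mem(1)]
    by (simp add: norm_minus_commute inner_add_left inner_diff_left inner_commute algebra_simps)
  also have "\<dots> \<le> \<eta> * (norm (x' - x) * norm d)"
    using \<eta> by (intro mult_left_mono norm_cauchy_schwarz) auto
  finally have "norm (x' - x) * norm (x' - x) \<le> norm (x' - x) * (\<eta> * norm d)"
    by (simp add: power2_eq_square algebra_simps)
  then have "norm (x' - x) \<le> \<eta> * norm d"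
    using \<eta> by (cases "norm (x' - x) = 0") auto
  then have "norm (x' - x) * norm d \<le> \<eta> * norm d * norm d"
    by (rule mult_right_mono) simp
  with norm_cauchy_schwarz[of "x' - x" d] show ?thesis by (simp add: power2_eq_square algebra_simps)
qed

text \<open>Here the leader cheats: \<open>A (map d [1..<Suc t])\<close> has already seen
  \<open>d t\<close>. In the induction \<open>z\<close> must stay general, since the hypothesis is
  applied to the leader after all \<open>Suc n\<close> rounds.\<close>

lemma be_the_regularized_leader:
  assumes A: "follows_regularized_leader K \<Phi> \<eta> A" and z: "z \<in> K"
  shows "\<eta> * (\<Sum>t=1..n. z \<bullet> d t) - \<Phi> z \<le> \<eta> * (\<Sum>t=1..n. A (map d [1..<Suc t]) \<bullet> d t) - \<Phi> (A [])"
  using z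
proof (induction n arbitrary: z)
  case 0
  then show ?case using A unfolding follows_regularized_leader_def is_arg_max_linorder
    by (auto dest: spec[of _ "[]"])
next
  case (Suc n)
  have sum: "(\<Sum>d\<leftarrow>map d [1..<Suc m]. w \<bullet> d) = (\<Sum>t=1..m. w \<bullet> d t)" for w m
    by (simp add: comp_def interv_sum_list_conv_sum_set_nat atLeastLessThanSuc_atLeastAtMost del: upt_Suc)
  define x where "x = A (map d [1..<Suc (Suc n)])"
  have x: "x \<in> K" "\<And>w. w \<in> K \<Longrightarrow>
      \<eta> * (\<Sum>t=1..Suc n. w \<bullet> d t) - \<Phi> w \<le> \<eta> * (\<Sum>t=1..Suc n. x \<bullet> d t) - \<Phi> x"
    using A unfolding follows_regularized_leader_def is_arg_max_linorder x_def sum[symmetric] by blast+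
  have "\<eta> * (\<Sum>t=1..Suc n. z \<bullet> d t) - \<Phi> z \<le> (\<eta> * (\<Sum>t=1..n. x \<bullet> d t) - \<Phi> x) + \<eta> * (x \<bullet> d (Suc n))"
    using x(2)[OF Suc.prems] by (simp add: algebra_simps)
  also have "\<dots> \<le> \<eta> * (\<Sum>t=1..n. A (map d [1..<Suc t]) \<bullet> d t) - \<Phi> (A []) + \<eta> * (x \<bullet> d (Suc n))"
    using Suc.IH[OF x(1)] by simp
  also have "\<dots> = \<eta> * (\<Sum>t=1..Suc n. A (map d [1..<Suc t]) \<bullet> d t) - \<Phi> (A [])"
    by (simp add: x_def algebra_simps del: upt_Suc)
  finally show ?case .
qed

text \<open>The regret is that of the cheating leader, at most
  \<open>D\<^sup>2 / (2 * \<eta>)\<close>, plus the price of seeing each vector one round late, at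
  most \<open>T * \<eta> * G\<^sup>2\<close> by stability. The step size makes the two
  equal.\<close>

lemma RFTL_regret:
  fixes K :: "(real ^ 'n) set"
  assumes K: "convex K" "bounded K" and A: "is_RFTL K T G A" and T: "1 \<le> T"
    and G: "\<And>t. t \<in> {1..T} \<Longrightarrow> norm (d t) \<le> G" and z: "z \<in> K"
  shows "(\<Sum>t=1..T. z \<bullet> d t) - (\<Sum>t=1..T. A (map d [1..<t]) \<bullet> d t) \<le> diameter K * G * sqrt (2 * real T)"
proof -
  define D where "D = diameter K"
  define \<eta> where "\<eta> = D / (G * sqrt (2 * real T))"
  obtain \<Phi> where \<Phi>: "strongly_convex_on K \<Phi>" "\<And>x z. x \<in> K \<Longrightarrow> z \<in> K \<Longrightarrow> \<Phi> x - \<Phi> z \<le> D\<^sup>2 / 2"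
    and fl: "follows_regularized_leader K \<Phi> \<eta> A"
    using A unfolding is_RFTL_def \<eta>_def D_def by blast
  have AK: "A ds \<in> K" for ds
    using fl unfolding follows_regularized_leader_def is_arg_max_def by blast
  have D0: "0 \<le> D" unfolding D_def by (rule diameter_ge_0[OF K(2)])
  have G0: "0 \<le> G" using order_trans[OF norm_ge_zero G[of 1]] T by simp
  \<comment> \<open>The step size is 0 in both degenerate cases (for \<open>G = 0\<close> because
    division by 0 yields 0). Then either \<open>K\<close> is a single point or all revealed vectors
    vanish.\<close>
  consider "D = 0" | "G = 0" | "0 < D" "0 < G" using D0 G0 by linarith
  then have "(\<Sum>t=1..T. z \<bullet> d t) - (\<Sum>t=1..T. A (map d [1..<t]) \<bullet> d t) \<le> D * G * sqrt (2 * real T)"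
  proof cases
    case 1
    have "A ds = z" for ds
      using diameter_bounded_bound[OF K(2) AK[of ds] z] 1 by (simp add: D_def)
    then show ?thesis using 1 by simp
  next
    case 2
    then have "d t = 0" if "t \<in> {1..T}" for t using G[OF that] by simp
    then show ?thesis using 2 by simp
  next
    case 3
    then have \<eta>: "0 < \<eta>" using T by (simp add: \<eta>_def)
    have arg: "is_arg_max (\<lambda>x. (\<eta> *\<^sub>R sum_list ds) \<bullet> x - \<Phi> x) (\<lambda>x. x \<in> K) (A ds)" for ds
    proof -
      have "(\<Sum>d\<leftarrow>ds. x \<bullet> d) = sum_list ds \<bullet> x" for x
        by (induction ds) (auto simp: inner_add_left inner_commute[of x])
      then show ?thesis
        using fl[unfolded follows_regularized_leader_def, rule_format, of ds] by simp
    qed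
    have stab: "(A (map d [1..<Suc t]) - A (map d [1..<t])) \<bullet> d t \<le> \<eta> * G\<^sup>2" if t: "t \<in> {1..T}" for t
    proof -
      have "(A (map d [1..<Suc t]) - A (map d [1..<t])) \<bullet> d t \<le> \<eta> * (norm (d t))\<^sup>2"
        using arg[of "map d [1..<Suc t]"] t
        by (intro RFTL_stability[OF K(1) \<Phi>(1) \<eta> arg]) (simp add: inner_add_left distrib_left)
      also have "\<dots> \<le> \<eta> * G\<^sup>2" using \<eta> G[OF t] by (intro mult_left_mono power_mono) auto
      finally show ?thesis .
    qed
    have "(\<Sum>t=1..T. (A (map d [1..<Suc t]) - A (map d [1..<t])) \<bullet> d t) \<le> (\<Sum>t=1..T. \<eta> * G\<^sup>2)"
      by (intro sum_mono stab)
    then have "(\<Sum>t=1..T. A (map d [1..<Suc t]) \<bullet> d t) - (\<Sum>t=1..T. A (map d [1..<t]) \<bullet> d t) \<le> real T * (\<eta> * G\<^sup>2)"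
      by (simp add: inner_diff_left sum_subtractf del: upt_Suc)
    moreover have "\<eta> * ((\<Sum>t=1..T. z \<bullet> d t) - (\<Sum>t=1..T. A (map d [1..<Suc t]) \<bullet> d t)) \<le> D\<^sup>2 / 2"
      using be_the_regularized_leader[OF fl z, of d T] \<Phi>(2)[OF z AK[of "[]"]]
      by (simp add: algebra_simps del: upt_Suc)
    then have "(\<Sum>t=1..T. z \<bullet> d t) - (\<Sum>t=1..T. A (map d [1..<Suc t]) \<bullet> d t) \<le> D\<^sup>2 / 2 / \<eta>"
      using \<eta> by (simp add: pos_le_divide_eq mult.commute)
    moreover have "D\<^sup>2 / 2 / \<eta> + real T * (\<eta> * G\<^sup>2) = D * G * sqrt (2 * real T)"
    proof -
      define q where "q = sqrt (2 * real T)"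
      have q: "0 < q" "real T = q * q / 2" using T by (auto simp: q_def)
      show ?thesis unfolding \<eta>_def q_def[symmetric] q(2) using 3 q(1)
        by (simp add: field_simps power2_eq_square)
    qed
    ultimately show ?thesis by linarith
  qed
  then show ?thesis by (simp add: D_def)
qed

section \<open>Measurability and unbiased estimators\<close>

text \<open>Random functions are only measurable at each fixed point, so composing them with a
  random point needs continuity: \<open>y\<close> is approximated by finitely-valued maps, for which
  the composition is measurable, and the limit is taken.\<close>

lemma borel_measurable_caratheodory:
  fixes y :: "'w \<Rightarrow> 'a :: euclidean_space" and F :: "'w \<Rightarrow> 'a \<Rightarrow> real"
  assumes S: "closed S" "convex S"
    and F: "\<And>x. x \<in> S \<Longrightarrow> (\<lambda>\<omega>. F \<omega> x) \<in> borel_measurable M"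
    and cont: "\<And>\<omega>. \<omega> \<in> space M \<Longrightarrow> continuous_on S (F \<omega>)"
    and y: "y \<in> borel_measurable M" "\<And>\<omega>. \<omega> \<in> space M \<Longrightarrow> y \<omega> \<in> S"
  shows "(\<lambda>\<omega>. F \<omega> (y \<omega>)) \<in> borel_measurable M"
proof (cases "space M = {}")
  case True
  then show ?thesis by (simp add: measurable_def)
next
  case False
  then have S_ne: "S \<noteq> {}" using y(2) by auto
  obtain U where U: "\<And>i. simple_function M (U i)" "\<And>\<omega>. \<omega> \<in> space M \<Longrightarrow> (\<lambda>i. U i \<omega>) \<longlonglongrightarrow> y \<omega>"
    using borel_measurable_implies_sequence_metric[OF y(1)] by blast
  \<comment> \<open>The approximations may leave \<open>S\<close>, where nothing is known about
    \<open>F\<close>; the continuous projection brings them back and fixes \<open>y\<close>.\<close>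
  have V: "closest_point S x \<in> S" for x by (rule closest_point_in_set[OF S(1) S_ne])
  show ?thesis
  proof (rule borel_measurable_LIMSEQ_real)
    fix \<omega> assume \<omega>: "\<omega> \<in> space M"
    have "(\<lambda>i. closest_point S (U i \<omega>)) \<longlonglongrightarrow> closest_point S (y \<omega>)"
      by (rule isCont_tendsto_compose[OF continuous_at_closest_point[OF S(2,1) S_ne] U(2)[OF \<omega>]])
    then show "(\<lambda>i. F \<omega> (closest_point S (U i \<omega>))) \<longlonglongrightarrow> F \<omega> (y \<omega>)"
      using V y(2)[OF \<omega>] by (intro continuous_on_tendsto_compose[OF cont[OF \<omega>]])
        (auto simp: closest_point_self)
  next
    fix i
    have fin: "finite (U i ` space M)" using U(1) by (rule simple_functionD)
    have "U i \<in> measurable M (count_space (U i ` space M))"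
      unfolding measurable_count_space_eq2[OF fin]
      using simple_functionD(2)[OF U(1)] by auto
    then show "(\<lambda>\<omega>. F \<omega> (closest_point S (U i \<omega>))) \<in> borel_measurable M"
      by (rule measurable_compose_countable'[where f = "\<lambda>x \<omega>. F \<omega> (closest_point S x)", OF F[OF V]])
        (rule countable_finite[OF fin])
  qed
qed

lemma integrable_inner_bounded:
  fixes w d :: "'w \<Rightarrow> 'a :: euclidean_space"
  assumes [measurable]: "w \<in> borel_measurable M" and d: "integrable M d"
    and B: "\<And>\<omega>. \<omega> \<in> space M \<Longrightarrow> norm (w \<omega>) \<le> B"
  shows "integrable M (\<lambda>\<omega>. w \<omega> \<bullet> d \<omega>)"
proof (rule Bochner_Integration.integrable_bound)
  show "integrable M (\<lambda>\<omega>. B * norm (d \<omega>))" using d by simp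
  have [measurable]: "d \<in> borel_measurable M" using d by simp
  show "(\<lambda>\<omega>. w \<omega> \<bullet> d \<omega>) \<in> borel_measurable M" by measurable
  show "AE \<omega> in M. norm (w \<omega> \<bullet> d \<omega>) \<le> norm (B * norm (d \<omega>))"
  proof (rule AE_I2)
    fix \<omega> assume \<omega>: "\<omega> \<in> space M"
    have "norm (w \<omega> \<bullet> d \<omega>) \<le> norm (w \<omega>) * norm (d \<omega>)"
      by (simp add: Cauchy_Schwarz_ineq2)
    also have "\<dots> \<le> B * norm (d \<omega>)" using B[OF \<omega>] by (rule mult_right_mono) simp
    finally show "norm (w \<omega> \<bullet> d \<omega>) \<le> norm (B * norm (d \<omega>))" by simp
  qed
qed

text \<open>The conditional expectation \<open>H\<close> serves as an integrable version of the
  random gradient. Since \<open>u - x\<close> is measurable for the conditioning algebra, it can be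
  pulled out, so \<open>H\<close> and \<open>d\<close> have the same expected inner product with
  it.\<close>

lemma (in prob_space) unbiased_gradient_estimatorE:
  fixes f :: "'a \<Rightarrow> real ^ 'n \<Rightarrow> real"
  assumes f: "\<And>x. x \<in> cbox 0 1 \<Longrightarrow> (\<lambda>\<omega>. f \<omega> x) \<in> borel_measurable M"
    and p: "p \<in> borel_measurable M" and u: "u \<in> borel_measurable M"
    and ub: "unbiased_gradient_estimator M f p u d"
    and B: "\<And>\<omega>. \<omega> \<in> space M \<Longrightarrow> norm (u \<omega>) \<le> B"
  obtains H where "integrable M H" "AE \<omega> in M. H \<omega> = cube_gradient (f \<omega>) (p \<omega>)"
    "\<And>x. expectation (\<lambda>\<omega>. (u \<omega> - x) \<bullet> H \<omega>) = expectation (\<lambda>\<omega>. (u \<omega> - x) \<bullet> d \<omega>)"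
proof -
  define N where "N = information M f p u"
  define C where "C = (\<Union>x \<in> cbox 0 1. {(\<lambda>\<omega>. f \<omega> x) -` A \<inter> space M | A. A \<in> sets borel}) \<union>
      {p -` A \<inter> space M | A. A \<in> sets borel} \<union> {u -` A \<inter> space M | A. A \<in> sets borel}"
  have N: "N = sigma (space M) C" by (simp add: N_def information_def C_def)
  have CM: "C \<subseteq> sets M"
    using f p u unfolding C_def by (auto simp: measurable_sets)
  then have CP: "C \<subseteq> Pow (space M)" using sets.space_closed by blast
  have spN: "space N = space M" and setsN: "sets N = sigma_sets (space M) C"
    using CP by (auto simp: N space_measure_of_conv sets_measure_of)
  have sub: "subalgebra M N"
    unfolding subalgebra_def spN setsN using CM by (auto simp: sets.sigma_sets_subset)
  interpret N: finite_measure_subalgebra M N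
    using sub by unfold_locales
  have uN: "u \<in> borel_measurable N"
    unfolding measurable_def spN setsN by (auto simp: C_def intro!: sigma_sets.Basic)
  have d: "integrable M d" and ce: "\<And>k. AE \<omega> in M. real_cond_exp M N (\<lambda>\<omega>. d \<omega> $ k) \<omega> = cube_gradient (f \<omega>) (p \<omega>) $ k"
    using ub unfolding unbiased_gradient_estimator_def N_def by auto
  have dk: "integrable M (\<lambda>\<omega>. d \<omega> $ k)" for k
    using integrable_inner_left[of "axis k 1" M d] d by (simp add: inner_axis)
  define H where "H \<omega> = (\<chi> k. real_cond_exp M N (\<lambda>\<omega>. d \<omega> $ k) \<omega>)" for \<omega>
  show ?thesis
  proof
    have "H = (\<lambda>\<omega>. \<Sum>k\<in>UNIV. real_cond_exp M N (\<lambda>\<omega>. d \<omega> $ k) \<omega> *\<^sub>R axis k 1)"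
      by (simp add: H_def fun_eq_iff vec_eq_iff axis_def if_distrib cong: if_cong)
    then show H: "integrable M H"
      using N.real_cond_exp_int(1)[OF dk] by simp
    have "AE \<omega> in M. \<forall>k. real_cond_exp M N (\<lambda>\<omega>. d \<omega> $ k) \<omega> = cube_gradient (f \<omega>) (p \<omega>) $ k"
      using ce by (simp add: AE_all_countable)
    then show "AE \<omega> in M. H \<omega> = cube_gradient (f \<omega>) (p \<omega>)"
      by (rule AE_mp) (auto simp: H_def vec_eq_iff)
    fix x
    have 1: "integrable M (\<lambda>\<omega>. (u \<omega> - x) $ k * d \<omega> $ k)" for k
    proof -
      have "integrable M (\<lambda>\<omega>. (u \<omega> - x) \<bullet> (d \<omega> $ k *\<^sub>R axis k 1))"
      proof (rule integrable_inner_bounded[where B = "B + norm x"])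
        show "norm (u \<omega> - x) \<le> B + norm x" if "\<omega> \<in> space M" for \<omega>
          using B[OF that] norm_triangle_ineq4[of "u \<omega>" x] by linarith
      qed (use u dk in auto)
      then show ?thesis by (simp add: inner_axis mult.commute)
    qed
    \<comment> \<open>This is where \<open>u\<close> being part of \<open>information\<close>
      matters.\<close>
    have 2: "(\<lambda>\<omega>. (u \<omega> - x) $ k) \<in> borel_measurable N" for k
    proof -
      have "(\<lambda>\<omega>. (u \<omega> - x) \<bullet> axis k 1) \<in> borel_measurable N" using uN by simp
      then show ?thesis by (simp add: inner_axis)
    qed
    have 3: "(\<lambda>\<omega>. d \<omega> $ k) \<in> borel_measurable M" for k using dk by simp
    note R = N.real_cond_exp_intg[OF 1 2 3]
    have "expectation (\<lambda>\<omega>. (u \<omega> - x) \<bullet> H \<omega>)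
        = (\<Sum>k\<in>UNIV. expectation (\<lambda>\<omega>. (u \<omega> - x) $ k * real_cond_exp M N (\<lambda>\<omega>. d \<omega> $ k) \<omega>))"
      unfolding inner_vec_def H_def using R(1) by simp
    also have "\<dots> = (\<Sum>k\<in>UNIV. expectation (\<lambda>\<omega>. (u \<omega> - x) $ k * d \<omega> $ k))"
      by (simp only: R(2))
    also have "\<dots> = expectation (\<lambda>\<omega>. (u \<omega> - x) \<bullet> d \<omega>)"
      unfolding inner_vec_def using 1 by simp
    finally show "expectation (\<lambda>\<omega>. (u \<omega> - x) \<bullet> H \<omega>) = expectation (\<lambda>\<omega>. (u \<omega> - x) \<bullet> d \<omega>)" .
  qed
qed

section \<open>The leading factor\<close>

text \<open>It all rests on
  \<open>(1 - 2 * \<epsilon>) * (1 + \<epsilon>) \<le> 1 - \<epsilon>\<close>, which turns the decay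
  of the margin into the common factor of the closed form.\<close>

lemma leading_factor_step:
  fixes \<epsilon> :: real
  assumes \<epsilon>: "0 \<le> \<epsilon>" "\<epsilon> \<le> 1/2"
  shows "(1 - 2 * \<epsilon>) ^ i * ((1 + \<epsilon>) ^ Suc i - 1)
      \<le> (1 - 2 * \<epsilon>) * ((1 - 2 * \<epsilon>) ^ (i - 1) * ((1 + \<epsilon>) ^ i - 1)) + \<epsilon> * (1 - \<epsilon>) ^ i"
proof -
  have "0 \<le> (1 - 2 * \<epsilon>) * (1 + \<epsilon>)" using \<epsilon> by simp
  then have "((1 - 2 * \<epsilon>) * (1 + \<epsilon>)) ^ i \<le> (1 - \<epsilon>) ^ i"
    by (rule power_mono[rotated]) (simp add: algebra_simps)
  then have "\<epsilon> * ((1 - 2 * \<epsilon>) ^ i * (1 + \<epsilon>) ^ i) \<le> \<epsilon> * (1 - \<epsilon>) ^ i"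
    using \<epsilon> by (intro mult_left_mono) (auto simp: power_mult_distrib)
  \<comment> \<open>The truncated \<open>i - 1\<close> is harmless at \<open>i = 0\<close>, where
    the last factor is 0.\<close>
  moreover have "(1 - 2 * \<epsilon>) * ((1 - 2 * \<epsilon>) ^ (i - 1) * ((1 + \<epsilon>) ^ i - 1)) = (1 - 2 * \<epsilon>) ^ i * ((1 + \<epsilon>) ^ i - 1)"
    by (cases i) auto
  ultimately show ?thesis by (simp add: algebra_simps)
qed

text \<open>Both powers are compared with exponentials, using that \<open>L * \<epsilon>\<close>
  lies between \<open>ln 2 - \<epsilon>\<close> and \<open>ln 2\<close>: the first is at least
  \<open>(1 - \<epsilon>) / 4\<close> and the second at least
  \<open>2 - 4 * \<epsilon>\<close>.\<close>

lemma leading_factor_bound: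
  fixes \<epsilon> :: real
  assumes \<epsilon>: "0 < \<epsilon>" "\<epsilon> < 1/12" and L: "L = nat \<lfloor>ln 2 / \<epsilon>\<rfloor>"
  shows "1/4 - 3 * \<epsilon> \<le> (1 - 2 * \<epsilon>) ^ (L - 1) * ((1 + \<epsilon>) ^ L - 1)"
proof -
  have ln2: "0 < ln (2::real)" "ln 2 \<le> (0.7::real)" "2/3 \<le> ln (2::real)"
    using ln2_le_25_over_36 ln2_ge_two_thirds by auto
  have 0: "0 \<le> \<lfloor>ln 2 / \<epsilon>\<rfloor>" using \<epsilon> by simp
  have Lu: "real L \<le> ln 2 / \<epsilon>" and Ll: "ln 2 / \<epsilon> - 1 \<le> real L"
    unfolding L using 0 by (auto simp: of_nat_nat)
  have "1 \<le> ln 2 / \<epsilon>" using ln2 \<epsilon> by (simp add: field_simps)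
  then have L1: "1 \<le> L" unfolding L by linarith
  then have rL: "real (L - 1) = real L - 1" by simp
  \<comment> \<open>Chosen so that \<open>1 / (1 - 2 * \<epsilon>)\<close> is \<open>1 + x\<close>,
    which bounds \<open>1 - 2 * \<epsilon>\<close> from below by \<open>exp (- x)\<close>.\<close>
  define x where "x = 2 * \<epsilon> / (1 - 2 * \<epsilon>)"
  have x: "0 \<le> x" using \<epsilon> by (simp add: x_def)
  have "1 / (1 - 2 * \<epsilon>) = 1 + x" using \<epsilon> by (simp add: x_def field_simps)
  also have "\<dots> \<le> exp x" by simp
  finally have "exp (- x) \<le> 1 - 2 * \<epsilon>" using \<epsilon> by (simp add: exp_minus field_simps)
  then have "exp (- x) ^ (L - 1) \<le> (1 - 2 * \<epsilon>) ^ (L - 1)" by (intro power_mono) auto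
  moreover have "exp (- x) ^ (L - 1) = exp (- (x * (real L - 1)))"
    unfolding rL[symmetric] by (simp add: exp_of_nat_mult[symmetric] mult.commute)
  moreover have "x * (real L - 1) \<le> 2 * ln 2 + \<epsilon>"
  proof -
    have "x * (real L - 1) \<le> x * (ln 2 / \<epsilon> - 1)" using Lu x by (intro mult_left_mono) auto
    also have "\<dots> = (2 * ln 2 - 2 * \<epsilon>) / (1 - 2 * \<epsilon>)"
      using \<epsilon> by (simp add: x_def field_simps)
    also have "\<dots> \<le> 2 * ln 2 + \<epsilon>"
    proof -
      \<comment> \<open>Tight numerically: \<open>4 * ln 2 \<le> 2.8\<close>, while
        \<open>3 - 2 * \<epsilon>\<close> exceeds 2.83 for \<open>\<epsilon> < 1/12\<close>.\<close>
      have "0 \<le> \<epsilon> * (3 - 2 * \<epsilon> - 4 * ln 2)" using \<epsilon> ln2 by simp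
      also have "\<dots> = (2 * ln 2 + \<epsilon>) * (1 - 2 * \<epsilon>) - (2 * ln 2 - 2 * \<epsilon>)"
        by (simp add: algebra_simps)
      finally have "2 * ln 2 - 2 * \<epsilon> \<le> (2 * ln 2 + \<epsilon>) * (1 - 2 * \<epsilon>)" by simp
      then show ?thesis using \<epsilon> by (simp add: divide_le_eq)
    qed
    finally show ?thesis .
  qed
  ultimately have "exp (- (2 * ln 2 + \<epsilon>)) \<le> (1 - 2 * \<epsilon>) ^ (L - 1)" by (smt (verit) exp_le_cancel_iff)
  moreover have "exp (- (2 * ln 2 + \<epsilon>)) = exp (- \<epsilon>) / 4"
    by (simp add: exp_diff exp_double exp_minus field_simps exp_add)
  moreover have "1 - \<epsilon> \<le> exp (- \<epsilon>)" using exp_ge_add_one_self[of "- \<epsilon>"] by simp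
  then have "(1 - \<epsilon>) / 4 \<le> exp (- \<epsilon>) / 4" by simp
  ultimately have A: "(1 - \<epsilon>) / 4 \<le> (1 - 2 * \<epsilon>) ^ (L - 1)" by (metis order_trans)
  \<comment> \<open>Against \<open>ln 2\<close>, the exponent loses at most
    \<open>\<epsilon>\<close> to the floor in \<open>L\<close> and at most
    \<open>\<epsilon> * ln 2\<close> to the quadratic term.\<close>
  have "\<epsilon> - \<epsilon>\<^sup>2 \<le> ln (1 + \<epsilon>)" using \<epsilon> by (intro ln_one_plus_pos_lower_bound) auto
  then have "exp (\<epsilon> - \<epsilon>\<^sup>2) \<le> 1 + \<epsilon>" using \<epsilon> by (simp add: ln_ge_iff)
  then have "exp (\<epsilon> - \<epsilon>\<^sup>2) ^ L \<le> (1 + \<epsilon>) ^ L" by (intro power_mono) auto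
  moreover have "exp (\<epsilon> - \<epsilon>\<^sup>2) ^ L = exp (real L * (\<epsilon> - \<epsilon>\<^sup>2))" by (simp add: exp_of_nat_mult)
  moreover have "ln 2 - 2 * \<epsilon> \<le> real L * (\<epsilon> - \<epsilon>\<^sup>2)"
  proof -
    have "0 \<le> \<epsilon> * (1 + \<epsilon> - ln 2)" using \<epsilon> ln2 by simp
    also have "\<dots> = (ln 2 / \<epsilon> - 1) * (\<epsilon> - \<epsilon>\<^sup>2) - (ln 2 - 2 * \<epsilon>)"
      using \<epsilon> by (simp add: field_simps power2_eq_square)
    finally have "ln 2 - 2 * \<epsilon> \<le> (ln 2 / \<epsilon> - 1) * (\<epsilon> - \<epsilon>\<^sup>2)" by simp
    also have "\<dots> \<le> real L * (\<epsilon> - \<epsilon>\<^sup>2)"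
      using Ll \<epsilon> by (intro mult_right_mono) (auto simp: power2_eq_square mult_le_cancel_left1)
    finally show ?thesis .
  qed
  ultimately have "exp (ln 2 - 2 * \<epsilon>) \<le> (1 + \<epsilon>) ^ L" by (smt (verit) exp_le_cancel_iff)
  moreover have "exp (ln 2 - 2 * \<epsilon>) = 2 * exp (- (2 * \<epsilon>))" by (simp add: exp_diff exp_minus field_simps)
  moreover have "1 - 2 * \<epsilon> \<le> exp (- (2 * \<epsilon>))" using exp_ge_add_one_self[of "- (2 * \<epsilon>)"] by simp
  ultimately have B: "1 - 4 * \<epsilon> \<le> (1 + \<epsilon>) ^ L - 1" by linarith
  have "1/4 - 3 * \<epsilon> \<le> (1 - \<epsilon>) / 4 * (1 - 4 * \<epsilon>)"
    using \<epsilon> by (simp add: algebra_simps)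
  also have "\<dots> \<le> (1 - 2 * \<epsilon>) ^ (L - 1) * ((1 + \<epsilon>) ^ L - 1)"
    using A B \<epsilon> by (intro mult_mono) auto
  finally show ?thesis .
qed

section \<open>Runs of NMMFW\<close>

text \<open>The range \<open>\<epsilon> \<le> 1\<close> makes each update a convex combination; the
  stronger \<open>\<epsilon> \<le> 1/2\<close> enters only when the recursion is unrolled.\<close>

locale NMMFW = prob_space M
  for M :: "'w measure" +
  fixes K :: "(real ^ 'n) set"
    and D \<beta> \<epsilon> :: real
    and L T :: nat
    and F :: "nat \<Rightarrow> 'w \<Rightarrow> real ^ 'n \<Rightarrow> real"
    and E :: "nat \<Rightarrow> ('w, 'n) olo"
    and s y g :: "nat \<Rightarrow> nat \<Rightarrow> 'w \<Rightarrow> real ^ 'n"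
    and opt :: "real ^ 'n"
  assumes K_convex: "convex K" and K_cube: "K \<subseteq> cbox 0 1" and D_def: "D = diameter K"
    and F_nonneg: "\<And>t \<omega> x. t \<in> {1..T} \<Longrightarrow> \<omega> \<in> space M \<Longrightarrow> x \<in> cbox 0 1 \<Longrightarrow> 0 \<le> F t \<omega> x"
    and F_smooth: "\<And>t \<omega>. t \<in> {1..T} \<Longrightarrow> \<omega> \<in> space M \<Longrightarrow> smooth_on_cube \<beta> (F t \<omega>)"
    and F_DR: "\<And>t \<omega>. t \<in> {1..T} \<Longrightarrow> \<omega> \<in> space M \<Longrightarrow> DR_submodular (F t \<omega>)"
    and F_measurable: "\<And>t x. t \<in> {1..T} \<Longrightarrow> x \<in> cbox 0 1 \<Longrightarrow> (\<lambda>\<omega>. F t \<omega> x) \<in> borel_measurable M"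
    and F_integrable: "\<And>t x. t \<in> {1..T} \<Longrightarrow> x \<in> K \<Longrightarrow> integrable M (\<lambda>\<omega>. F t \<omega> x)"
    and run: "NMMFW_run M K L \<epsilon> T F E s y g"
    and opt_in_K: "opt \<in> K"
    and \<epsilon>: "0 < \<epsilon>" "\<epsilon> \<le> 1"
begin

definition margin :: real where
  "margin = 1 - (INF x\<in>K. infnorm x)"

definition optimum :: real where
  "optimum = expectation (\<lambda>\<omega>. \<Sum>t=1..T. F t \<omega> opt)"

text \<open>The algorithm earns \<open>reward L\<close>; the smaller indices are intermediate
  iterates through which the recursion runs.\<close>

definition reward :: "nat \<Rightarrow> real" where
  "reward i = (\<Sum>t=1..T. expectation (\<lambda>\<omega>. F t \<omega> (y i t \<omega>)))"

section \<open>Iterates of a run and signs of the quantities involved\<close>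

lemma K_bounded: "bounded K"
  using K_cube bounded_cbox bounded_subset by blast

lemma D_bound: "a \<in> K \<Longrightarrow> b \<in> K \<Longrightarrow> norm (a - b) \<le> D"
  using diameter_bounded_bound[OF K_bounded] by (simp add: D_def dist_norm)

lemma D_nonneg: "0 \<le> D"
  using diameter_ge_0[OF K_bounded] by (simp add: D_def)

lemma y_0:
  assumes "t \<in> {1..T}"
  shows "y 0 t \<in> borel_measurable M"
    and "\<omega> \<in> space M \<Longrightarrow> y 0 t \<omega> \<in> K"
    and "\<omega> \<in> space M \<Longrightarrow> x \<in> K \<Longrightarrow> infnorm (y 0 t \<omega>) \<le> infnorm x"
  using run assms unfolding NMMFW_run_def is_arg_min_linorder by auto

lemma run_step:
  assumes "t \<in> {1..T}" "i \<in> {1..L}"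
  shows "s i t \<in> borel_measurable M"
    and "\<omega> \<in> space M \<Longrightarrow> s i t \<omega> = E i \<omega> (map (\<lambda>\<tau>. g i \<tau> \<omega>) [1..<t])"
    and "\<omega> \<in> space M \<Longrightarrow> s i t \<omega> \<in> K"
    and "\<omega> \<in> space M \<Longrightarrow> y i t \<omega> = (1 - \<epsilon>) *\<^sub>R y (i - 1) t \<omega> + \<epsilon> *\<^sub>R s i t \<omega>"
    and "unbiased_gradient_estimator M (F t) (y (i - 1) t) (s i t) (g i t)"
    and "integrable M (g i t)"
proof -
  show ub: "unbiased_gradient_estimator M (F t) (y (i - 1) t) (s i t) (g i t)"
    and "s i t \<in> borel_measurable M"
    and s: "\<omega> \<in> space M \<Longrightarrow> s i t \<omega> = E i \<omega> (map (\<lambda>\<tau>. g i \<tau> \<omega>) [1..<t])"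
    and "\<omega> \<in> space M \<Longrightarrow> y i t \<omega> = (1 - \<epsilon>) *\<^sub>R y (i - 1) t \<omega> + \<epsilon> *\<^sub>R s i t \<omega>"
    using run assms unfolding NMMFW_run_def by blast+
  show "\<omega> \<in> space M \<Longrightarrow> s i t \<omega> \<in> K"
    using run assms s unfolding NMMFW_run_def by auto
  show "integrable M (g i t)" using ub unfolding unbiased_gradient_estimator_def by blast
qed

lemma y_in_K:
  assumes t: "t \<in> {1..T}" and \<omega>: "\<omega> \<in> space M" and "i \<le> L"
  shows "y i t \<omega> \<in> K"
  using assms(3)
proof (induction i)
  case 0
  then show ?case using y_0(2)[OF t \<omega>] by simp
next
  case (Suc i)
  then have i: "Suc i \<in> {1..L}" by simp
  show ?case
    using run_step(4)[OF t i \<omega>] run_step(3)[OF t i \<omega>] Suc \<epsilon> convexD[OF K_convex] by auto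
qed

lemma y_measurable:
  assumes t: "t \<in> {1..T}" and "i \<le> L"
  shows "y i t \<in> borel_measurable M"
  using assms(2)
proof (induction i)
  case 0
  then show ?case using y_0(1)[OF t] by simp
next
  case (Suc i)
  then have i: "Suc i \<in> {1..L}" by simp
  have [measurable]: "y i t \<in> borel_measurable M" "s (Suc i) t \<in> borel_measurable M"
    using Suc run_step(1)[OF t i] by auto
  have "(\<lambda>\<omega>. (1 - \<epsilon>) *\<^sub>R y i t \<omega> + \<epsilon> *\<^sub>R s (Suc i) t \<omega>) \<in> borel_measurable M" by measurable
  then show ?case
    by (rule measurable_cong[THEN iffD1, rotated]) (use run_step(4)[OF t i] in auto)
qed

lemma infnorm_y:
  assumes t: "t \<in> {1..T}" and \<omega>: "\<omega> \<in> space M" and "i \<le> L"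
  shows "(1 - \<epsilon>) ^ i * margin \<le> 1 - infnorm (y i t \<omega>)"
  using assms(3)
proof (induction i)
  case 0
  have "infnorm (y 0 t \<omega>) \<le> (INF x\<in>K. infnorm x)"
    using opt_in_K y_0(3)[OF t \<omega>] by (intro cINF_greatest) auto
  then show ?case by (simp add: margin_def)
next
  case (Suc i)
  then have i: "Suc i \<in> {1..L}" by simp
  have "infnorm (y (Suc i) t \<omega>) \<le> (1 - \<epsilon>) * infnorm (y i t \<omega>) + \<epsilon> * infnorm (s (Suc i) t \<omega>)"
    using run_step(4)[OF t i \<omega>] infnorm_triangle[of "(1 - \<epsilon>) *\<^sub>R y i t \<omega>" "\<epsilon> *\<^sub>R s (Suc i) t \<omega>"] \<epsilon>
    by (simp add: infnorm_mul)
  moreover have "\<epsilon> * infnorm (s (Suc i) t \<omega>) \<le> \<epsilon> * 1"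
    using run_step(3)[OF t i \<omega>] K_cube \<epsilon> by (intro mult_left_mono infnorm_cube_le_1) auto
  moreover have "(1 - \<epsilon>) * ((1 - \<epsilon>) ^ i * margin) \<le> (1 - \<epsilon>) * (1 - infnorm (y i t \<omega>))"
    using Suc \<epsilon> by (intro mult_left_mono) auto
  ultimately show ?case by (simp add: algebra_simps)
qed

lemma margin_nonneg: "0 \<le> margin"
proof -
  have "(INF x\<in>K. infnorm x) \<le> infnorm opt"
    by (rule cINF_lower[OF _ opt_in_K]) (auto intro!: bdd_belowI[of _ 0] simp: infnorm_pos_le)
  with infnorm_cube_le_1[of opt] opt_in_K K_cube show ?thesis by (auto simp: margin_def)
qed

lemma optimum_eq: "optimum = (\<Sum>t=1..T. expectation (\<lambda>\<omega>. F t \<omega> opt))"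
  unfolding optimum_def using F_integrable opt_in_K by (intro Bochner_Integration.integral_sum) auto

lemma optimum_nonneg: "0 \<le> optimum"
  unfolding optimum_def using F_nonneg opt_in_K K_cube
  by (intro Bochner_Integration.integral_nonneg sum_nonneg) auto

lemma reward_nonneg: "i \<le> L \<Longrightarrow> 0 \<le> reward i"
  unfolding reward_def using F_nonneg y_in_K K_cube
  by (intro sum_nonneg Bochner_Integration.integral_nonneg) (auto simp: subset_iff)

section \<open>Integrability and the expected gain of one averaging step\<close>

lemma gradient_estimate:
  assumes t: "t \<in> {1..T}" and i: "i \<in> {1..L}"
  obtains H where "integrable M H" "AE \<omega> in M. H \<omega> = cube_gradient (F t \<omega>) (y (i - 1) t \<omega>)"
    "\<And>x. expectation (\<lambda>\<omega>. (s i t \<omega> - x) \<bullet> H \<omega>) = expectation (\<lambda>\<omega>. (s i t \<omega> - x) \<bullet> g i t \<omega>)"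
proof -
  obtain B where B: "\<And>x. x \<in> K \<Longrightarrow> norm x \<le> B" using K_bounded bounded_iff by blast
  have "y (i - 1) t \<in> borel_measurable M" using y_measurable[OF t, of "i - 1"] i by auto
  from unbiased_gradient_estimatorE[OF F_measurable[OF t] this run_step(1)[OF t i] run_step(5)[OF t i] B[OF run_step(3)[OF t i]]]
  show ?thesis using that by blast
qed

text \<open>Integrability is only assumed at fixed points of \<open>K\<close>. The gradient at \<open>y 0 t\<close> is a
  conditional expectation, hence integrable, and controls \<open>F t\<close> on all of \<open>K\<close>.\<close>

lemma integrable_F_y:
  assumes t: "t \<in> {1..T}" and L: "1 \<le> L" and i: "i \<le> L"
  shows "integrable M (\<lambda>\<omega>. F t \<omega> (y i t \<omega>))"
proof -
  \<comment> \<open>\<open>g 1 t\<close> is the estimator at \<open>y 0 t\<close>, hence the need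
    for \<open>1 \<le> L\<close>.\<close>
  obtain H where H: "integrable M H" "AE \<omega> in M. H \<omega> = cube_gradient (F t \<omega>) (y 0 t \<omega>)"
    using gradient_estimate[OF t, of 1] L by auto
  show ?thesis
  proof (rule Bochner_Integration.integrable_bound)
    show "integrable M (\<lambda>\<omega>. F t \<omega> opt + 2 * D * norm (H \<omega>) + \<beta> * D\<^sup>2)"
      using H(1) F_integrable[OF t opt_in_K] by simp
    show "(\<lambda>\<omega>. F t \<omega> (y i t \<omega>)) \<in> borel_measurable M"
    proof (rule borel_measurable_caratheodory[where S = "cbox 0 1" and F = "F t" and y = "y i t"])
      show "continuous_on (cbox 0 1) (F t \<omega>)" if "\<omega> \<in> space M" for \<omega>
        using F_smooth[OF t that] differentiable_imp_continuous_on unfolding smooth_on_cube_def by blast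
    qed (use F_measurable[OF t] y_measurable[OF t i] y_in_K[OF t _ i] K_cube in auto)
    show "AE \<omega> in M. norm (F t \<omega> (y i t \<omega>)) \<le> norm (F t \<omega> opt + 2 * D * norm (H \<omega>) + \<beta> * D\<^sup>2)"
      using H(2)
    proof (rule AE_mp, intro AE_I2 impI)
      fix \<omega> assume \<omega>: "\<omega> \<in> space M" and eq: "H \<omega> = cube_gradient (F t \<omega>) (y 0 t \<omega>)"
      note sm = F_smooth[OF t \<omega>]
      have K: "y 0 t \<omega> \<in> K" "y i t \<omega> \<in> K" using y_in_K[OF t \<omega>] i by auto
      then have cube: "y 0 t \<omega> \<in> cbox 0 1" "y i t \<omega> \<in> cbox 0 1" "opt \<in> cbox 0 1"
        using K_cube opt_in_K by auto
      have bd: "\<bar>H \<omega> \<bullet> (z - y 0 t \<omega>)\<bar> \<le> norm (H \<omega>) * D" "\<beta> / 2 * (norm (z - y 0 t \<omega>))\<^sup>2 \<le> \<beta> / 2 * D\<^sup>2"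
        if "z \<in> K" for z
      proof -
        show "\<bar>H \<omega> \<bullet> (z - y 0 t \<omega>)\<bar> \<le> norm (H \<omega>) * D"
          by (rule order_trans[OF Cauchy_Schwarz_ineq2]) (intro mult_left_mono D_bound that K, simp)
        show "\<beta> / 2 * (norm (z - y 0 t \<omega>))\<^sup>2 \<le> \<beta> / 2 * D\<^sup>2"
          using smooth_on_cube_nonneg[OF sm] by (intro mult_left_mono power_mono D_bound that K) auto
      qed
      \<comment> \<open>The detour through \<open>y 0 t\<close> uses the upper smoothness bound at
        \<open>y i t\<close> and the lower one at \<open>opt\<close>, so the integrable
        \<open>F t \<omega> opt\<close> controls the value.\<close>
      have "F t \<omega> (y i t \<omega>) \<le> F t \<omega> opt + 2 * D * norm (H \<omega>) + \<beta> * D\<^sup>2"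
        using smooth_on_cube_bounds(1)[OF sm cube(1,3)] smooth_on_cube_bounds(2)[OF sm cube(1,2)]
          bd[OF opt_in_K] bd[OF K(2)] unfolding eq[symmetric] by (simp add: algebra_simps)
      then show "norm (F t \<omega> (y i t \<omega>)) \<le> norm (F t \<omega> opt + 2 * D * norm (H \<omega>) + \<beta> * D\<^sup>2)"
        using F_nonneg[OF t \<omega> cube(2)] by simp
    qed
  qed
qed

text \<open>The pointwise step is integrated with \<open>H\<close> in place of the gradient;
  afterwards \<open>HE\<close> exchanges \<open>H\<close> for the estimator that the optimizer
  actually receives.\<close>

lemma expected_step:
  assumes t: "t \<in> {1..T}" and i: "Suc i \<in> {1..L}"
  shows "(1 - 2 * \<epsilon>) * expectation (\<lambda>\<omega>. F t \<omega> (y i t \<omega>))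
      + \<epsilon> * ((1 - \<epsilon>) ^ i * margin * expectation (\<lambda>\<omega>. F t \<omega> opt))
      + \<epsilon> * expectation (\<lambda>\<omega>. (s (Suc i) t \<omega> - opt) \<bullet> g (Suc i) t \<omega>) - 0.5 * \<epsilon>\<^sup>2 * \<beta> * D\<^sup>2
    \<le> expectation (\<lambda>\<omega>. F t \<omega> (y (Suc i) t \<omega>))"
proof -
  obtain H where H: "integrable M H" "AE \<omega> in M. H \<omega> = cube_gradient (F t \<omega>) (y i t \<omega>)"
    and HE: "\<And>x. expectation (\<lambda>\<omega>. (s (Suc i) t \<omega> - x) \<bullet> H \<omega>) = expectation (\<lambda>\<omega>. (s (Suc i) t \<omega> - x) \<bullet> g (Suc i) t \<omega>)"
    using gradient_estimate[OF t i] by auto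
  have L: "1 \<le> L" "i \<le> L" "Suc i \<le> L" using i by auto
  have int: "integrable M (\<lambda>\<omega>. F t \<omega> (y i t \<omega>))" "integrable M (\<lambda>\<omega>. F t \<omega> (y (Suc i) t \<omega>))"
    "integrable M (\<lambda>\<omega>. F t \<omega> opt)"
    using integrable_F_y[OF t L(1)] L F_integrable[OF t opt_in_K] by auto
  have intH: "integrable M (\<lambda>\<omega>. (s (Suc i) t \<omega> - opt) \<bullet> H \<omega>)"
    using run_step(1,3)[OF t i] D_bound opt_in_K by (intro integrable_inner_bounded[OF _ H(1)]) auto
  have "expectation (\<lambda>\<omega>. (1 - 2 * \<epsilon>) * F t \<omega> (y i t \<omega>) + \<epsilon> * ((1 - \<epsilon>) ^ i * margin * F t \<omega> opt)
      + \<epsilon> * ((s (Suc i) t \<omega> - opt) \<bullet> H \<omega>) - 0.5 * \<epsilon>\<^sup>2 * \<beta> * D\<^sup>2)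
    \<le> expectation (\<lambda>\<omega>. F t \<omega> (y (Suc i) t \<omega>))"
  proof (rule integral_mono_AE)
    show "AE \<omega> in M. (1 - 2 * \<epsilon>) * F t \<omega> (y i t \<omega>) + \<epsilon> * ((1 - \<epsilon>) ^ i * margin * F t \<omega> opt)
      + \<epsilon> * ((s (Suc i) t \<omega> - opt) \<bullet> H \<omega>) - 0.5 * \<epsilon>\<^sup>2 * \<beta> * D\<^sup>2 \<le> F t \<omega> (y (Suc i) t \<omega>)"
      using H(2)
    proof (rule AE_mp, intro AE_I2 impI)
      fix \<omega> assume \<omega>: "\<omega> \<in> space M" and eq: "H \<omega> = cube_gradient (F t \<omega>) (y i t \<omega>)"
      have K: "y i t \<omega> \<in> K" "s (Suc i) t \<omega> \<in> K" using y_in_K[OF t \<omega>] L run_step(3)[OF t i \<omega>] by auto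
      have "(1 - 2 * \<epsilon>) * F t \<omega> (y i t \<omega>) + \<epsilon> * ((1 - infnorm (y i t \<omega>)) * F t \<omega> opt)
          + \<epsilon> * ((s (Suc i) t \<omega> - opt) \<bullet> H \<omega>) - 0.5 * \<epsilon>\<^sup>2 * \<beta> * D\<^sup>2 \<le> F t \<omega> (y (Suc i) t \<omega>)"
        using frank_wolfe_step[OF F_DR[OF t \<omega>] F_smooth[OF t \<omega>] F_nonneg[OF t \<omega>], of opt "y i t \<omega>" "s (Suc i) t \<omega>" \<epsilon> D]
          K opt_in_K K_cube \<epsilon> D_bound[OF K(2,1)] run_step(4)[OF t i \<omega>] unfolding eq by auto
      moreover have "\<epsilon> * ((1 - \<epsilon>) ^ i * margin * F t \<omega> opt) \<le> \<epsilon> * ((1 - infnorm (y i t \<omega>)) * F t \<omega> opt)"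
        using infnorm_y[OF t \<omega> L(2)] F_nonneg[OF t \<omega>] opt_in_K K_cube \<epsilon>
        by (intro mult_left_mono mult_right_mono) auto
      ultimately show "(1 - 2 * \<epsilon>) * F t \<omega> (y i t \<omega>) + \<epsilon> * ((1 - \<epsilon>) ^ i * margin * F t \<omega> opt)
          + \<epsilon> * ((s (Suc i) t \<omega> - opt) \<bullet> H \<omega>) - 0.5 * \<epsilon>\<^sup>2 * \<beta> * D\<^sup>2 \<le> F t \<omega> (y (Suc i) t \<omega>)"
        by linarith
    qed
  qed (use int intH in auto)
  then show ?thesis using int intH by (simp add: HE prob_space)
qed

section \<open>From regret to a recursion for the rewards\<close>

lemma regret_at_optimum:
  assumes i: "i \<in> {1..L}" and R: "has_regret M K T (s i) (g i) R"
  shows "- R \<le> (\<Sum>t=1..T. expectation (\<lambda>\<omega>. (s i t \<omega> - opt) \<bullet> g i t \<omega>))"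
proof -
  obtain B where B: "\<And>x. x \<in> K \<Longrightarrow> norm x \<le> B" using K_bounded bounded_iff by blast
  have int: "integrable M (\<lambda>\<omega>. s i t \<omega> \<bullet> g i t \<omega>)" "integrable M (\<lambda>\<omega>. x \<bullet> g i t \<omega>)"
    if t: "t \<in> {1..T}" for t x
    using run_step[OF t i] B by (auto intro!: integrable_inner_bounded[where B = B])
  have ex: "expectation (\<lambda>\<omega>. \<Sum>t=1..T. x \<bullet> g i t \<omega>) = x \<bullet> (\<Sum>t=1..T. expectation (g i t))" for x
    using int(2) run_step(6)[OF _ i] by (simp add: inner_sum_right)
  have "expectation (\<lambda>\<omega>. \<Sum>t=1..T. opt \<bullet> g i t \<omega>) \<le> (SUP x\<in>K. expectation (\<lambda>\<omega>. \<Sum>t=1..T. x \<bullet> g i t \<omega>))"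
  \<comment> \<open>A real \<open>SUP\<close> is an upper bound only for sets bounded above. The
    expected linear reward is linear in \<open>x\<close>, hence bounded on \<open>K\<close> by
    Cauchy-Schwarz.\<close>
  proof (rule cSUP_upper[OF opt_in_K], rule bdd_aboveI2)
    fix x assume "x \<in> K"
    show "expectation (\<lambda>\<omega>. \<Sum>t=1..T. x \<bullet> g i t \<omega>) \<le> B * norm (\<Sum>t=1..T. expectation (g i t))"
      unfolding ex by (rule order_trans[OF norm_cauchy_schwarz]) (intro mult_right_mono B \<open>x \<in> K\<close> norm_ge_zero)
  qed
  with R have "expectation (\<lambda>\<omega>. \<Sum>t=1..T. opt \<bullet> g i t \<omega>) - R \<le> expectation (\<lambda>\<omega>. \<Sum>t=1..T. s i t \<omega> \<bullet> g i t \<omega>)"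
    unfolding has_regret_def by linarith
  moreover have "(\<Sum>t=1..T. expectation (\<lambda>\<omega>. (s i t \<omega> - opt) \<bullet> g i t \<omega>))
      = expectation (\<lambda>\<omega>. \<Sum>t=1..T. s i t \<omega> \<bullet> g i t \<omega>) - expectation (\<lambda>\<omega>. \<Sum>t=1..T. opt \<bullet> g i t \<omega>)"
    using int by (simp add: inner_diff_left sum_subtractf)
  ultimately show ?thesis by linarith
qed

lemma reward_step:
  assumes i: "Suc i \<in> {1..L}" and R: "has_regret M K T (s (Suc i)) (g (Suc i)) R"
  shows "(1 - 2 * \<epsilon>) * reward i + \<epsilon> * (1 - \<epsilon>) ^ i * (margin * optimum)
      - (\<epsilon> * R + 0.5 * \<epsilon>\<^sup>2 * \<beta> * D\<^sup>2 * real T) \<le> reward (Suc i)"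
proof -
  have "(\<Sum>t=1..T. (1 - 2 * \<epsilon>) * expectation (\<lambda>\<omega>. F t \<omega> (y i t \<omega>))
      + \<epsilon> * ((1 - \<epsilon>) ^ i * margin * expectation (\<lambda>\<omega>. F t \<omega> opt))
      + \<epsilon> * expectation (\<lambda>\<omega>. (s (Suc i) t \<omega> - opt) \<bullet> g (Suc i) t \<omega>) - 0.5 * \<epsilon>\<^sup>2 * \<beta> * D\<^sup>2) \<le> reward (Suc i)"
    unfolding reward_def by (intro sum_mono expected_step i)
  moreover have "(\<Sum>t=1..T. (1 - 2 * \<epsilon>) * expectation (\<lambda>\<omega>. F t \<omega> (y i t \<omega>))
      + \<epsilon> * ((1 - \<epsilon>) ^ i * margin * expectation (\<lambda>\<omega>. F t \<omega> opt))
      + \<epsilon> * expectation (\<lambda>\<omega>. (s (Suc i) t \<omega> - opt) \<bullet> g (Suc i) t \<omega>) - 0.5 * \<epsilon>\<^sup>2 * \<beta> * D\<^sup>2)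
    = (1 - 2 * \<epsilon>) * reward i + \<epsilon> * (1 - \<epsilon>) ^ i * (margin * optimum)
      + \<epsilon> * (\<Sum>t=1..T. expectation (\<lambda>\<omega>. (s (Suc i) t \<omega> - opt) \<bullet> g (Suc i) t \<omega>)) - 0.5 * \<epsilon>\<^sup>2 * \<beta> * D\<^sup>2 * real T"
    by (simp add: sum.distrib sum_subtractf sum_distrib_left[symmetric] reward_def optimum_eq mult.assoc)
  moreover have "\<epsilon> * - R \<le> \<epsilon> * (\<Sum>t=1..T. expectation (\<lambda>\<omega>. (s (Suc i) t \<omega> - opt) \<bullet> g (Suc i) t \<omega>))"
    using \<epsilon> by (intro mult_left_mono regret_at_optimum[OF i R]) auto
  ultimately show ?thesis by (simp add: algebra_simps)
qed

lemma \<beta>_nonneg: "1 \<le> T \<Longrightarrow> 0 \<le> \<beta>"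
  using smooth_on_cube_nonneg[OF F_smooth[of 1]] not_empty by auto

lemma reward_bound:
  assumes R: "0 \<le> R" "\<And>i. i \<in> {1..L} \<Longrightarrow> has_regret M K T (s i) (g i) R" and half: "\<epsilon> \<le> 1/2" and i: "i \<le> L"
  shows "(1 - 2 * \<epsilon>) ^ (i - 1) * ((1 + \<epsilon>) ^ i - 1) * (margin * optimum)
      - real i * (\<epsilon> * R + 0.5 * \<epsilon>\<^sup>2 * \<beta> * D\<^sup>2 * real T) \<le> reward i"
  using i
proof (induction i)
  case 0
  \<comment> \<open>The closed form starts at 0 because
    \<open>(1 + \<epsilon>) ^ 0 - 1 = 0\<close>.\<close>
  then show ?case using reward_nonneg[of 0] by simp
next
  case (Suc i)
  define c where "c = \<epsilon> * R + 0.5 * \<epsilon>\<^sup>2 * \<beta> * D\<^sup>2 * real T"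
  define q where "q = (1 - 2 * \<epsilon>) ^ (i - 1) * ((1 + \<epsilon>) ^ i - 1)"
  have c: "0 \<le> c"
    using R \<epsilon> \<beta>_nonneg by (cases "T = 0") (auto simp: c_def)
  have "(1 - 2 * \<epsilon>) * (q * (margin * optimum) - real i * c) \<le> (1 - 2 * \<epsilon>) * reward i"
    using Suc half by (intro mult_left_mono) (auto simp: c_def q_def)
  moreover have "(1 - 2 * \<epsilon>) * reward i + \<epsilon> * (1 - \<epsilon>) ^ i * (margin * optimum) - c \<le> reward (Suc i)"
    unfolding c_def using Suc.prems by (intro reward_step R) auto
  moreover have "((1 - 2 * \<epsilon>) ^ i * ((1 + \<epsilon>) ^ Suc i - 1)) * (margin * optimum)
      \<le> ((1 - 2 * \<epsilon>) * q + \<epsilon> * (1 - \<epsilon>) ^ i) * (margin * optimum)"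
    unfolding q_def using half \<epsilon> margin_nonneg optimum_nonneg
    by (intro mult_right_mono leading_factor_step) auto
  \<comment> \<open>The factor \<open>1 - 2 * \<epsilon>\<close> also shrinks the accumulated error;
    dropping that gain leaves one \<open>c\<close> per step.\<close>
  moreover have "0 \<le> \<epsilon> * (real i * c)" using c \<epsilon> by simp
  ultimately have "((1 - 2 * \<epsilon>) ^ i * ((1 + \<epsilon>) ^ Suc i - 1)) * (margin * optimum) - real (Suc i) * c \<le> reward (Suc i)"
    by (simp add: algebra_simps)
  then show ?case by (simp add: c_def)
qed

section \<open>Specialization to Regularized-Follow-the-Leader\<close>

lemma RFTL_has_regret:
  assumes T: "1 \<le> T" and i: "i \<in> {1..L}" and G: "\<And>t \<omega>. t \<in> {1..T} \<Longrightarrow> \<omega> \<in> space M \<Longrightarrow> norm (g i t \<omega>) \<le> G"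
    and A: "\<And>\<omega>. \<omega> \<in> space M \<Longrightarrow> is_RFTL K T G (E i \<omega>)"
  shows "has_regret M K T (s i) (g i) (D * G * sqrt (2 * real T))"
proof -
  obtain B where B: "\<And>x. x \<in> K \<Longrightarrow> norm x \<le> B" using K_bounded bounded_iff by blast
  have int: "integrable M (\<lambda>\<omega>. s i t \<omega> \<bullet> g i t \<omega>)" "integrable M (\<lambda>\<omega>. x \<bullet> g i t \<omega>)"
    if t: "t \<in> {1..T}" for t x
    using run_step[OF t i] B by (auto intro!: integrable_inner_bounded[where B = B])
  have "(SUP x\<in>K. expectation (\<lambda>\<omega>. \<Sum>t=1..T. x \<bullet> g i t \<omega>))
      \<le> expectation (\<lambda>\<omega>. \<Sum>t=1..T. s i t \<omega> \<bullet> g i t \<omega>) + D * G * sqrt (2 * real T)"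
  proof (rule cSUP_least)
    fix x assume x: "x \<in> K"
    \<comment> \<open>The deterministic regret bound holds for every outcome, so it survives taking
      expectations.\<close>
    have "expectation (\<lambda>\<omega>. \<Sum>t=1..T. x \<bullet> g i t \<omega>)
        \<le> expectation (\<lambda>\<omega>. (\<Sum>t=1..T. s i t \<omega> \<bullet> g i t \<omega>) + D * G * sqrt (2 * real T))"
    proof (rule integral_mono)
      fix \<omega> assume \<omega>: "\<omega> \<in> space M"
      have "(\<Sum>t=1..T. x \<bullet> g i t \<omega>) - (\<Sum>t=1..T. E i \<omega> (map (\<lambda>t. g i t \<omega>) [1..<t]) \<bullet> g i t \<omega>)
          \<le> diameter K * G * sqrt (2 * real T)"
        using G \<omega> by (intro RFTL_regret[OF K_convex K_bounded A[OF \<omega>] T _ x]) auto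
      moreover have "(\<Sum>t=1..T. E i \<omega> (map (\<lambda>t. g i t \<omega>) [1..<t]) \<bullet> g i t \<omega>) = (\<Sum>t=1..T. s i t \<omega> \<bullet> g i t \<omega>)"
        using run_step(2)[OF _ i \<omega>] by (intro sum.cong) auto
      ultimately show "(\<Sum>t=1..T. x \<bullet> g i t \<omega>) \<le> (\<Sum>t=1..T. s i t \<omega> \<bullet> g i t \<omega>) + D * G * sqrt (2 * real T)"
        by (simp add: D_def)
    qed (use int in \<open>auto intro!: Bochner_Integration.integrable_add Bochner_Integration.integrable_sum\<close>)
    also have "\<dots> = expectation (\<lambda>\<omega>. \<Sum>t=1..T. s i t \<omega> \<bullet> g i t \<omega>) + D * G * sqrt (2 * real T)"
      using int by (subst Bochner_Integration.integral_add)
        (auto intro!: Bochner_Integration.integrable_sum simp: prob_space)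
    finally show "expectation (\<lambda>\<omega>. \<Sum>t=1..T. x \<bullet> g i t \<omega>)
        \<le> expectation (\<lambda>\<omega>. \<Sum>t=1..T. s i t \<omega> \<bullet> g i t \<omega>) + D * G * sqrt (2 * real T)" .
  qed (use opt_in_K in auto)
  then show ?thesis unfolding has_regret_def by linarith
qed

lemma RFTL_reward_bound:
  assumes T: "1 \<le> T" and eps: "\<epsilon> = 1 / sqrt (real T)" and L: "L = nat \<lfloor>ln 2 / \<epsilon>\<rfloor>"
    and bdd: "bdd_above (estimator_norms M L T g)" and G: "G = max_estimator_norm M L T g"
    and A: "\<And>i \<omega>. i \<in> {1..L} \<Longrightarrow> \<omega> \<in> space M \<Longrightarrow> is_RFTL K T G (E i \<omega>)"
  shows "(1/4 - 3 * \<epsilon>) * (margin * optimum) - (G + \<beta> * D) * D * sqrt (real T) \<le> reward L"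
proof -
  have bdd': "bdd_above (insert 0 (estimator_norms M L T g))" using bdd by simp
  have G0: "0 \<le> G" unfolding G max_estimator_norm_def by (rule cSup_upper[OF _ bdd']) simp
  have Gb: "norm (g i t \<omega>) \<le> G" if "i \<in> {1..L}" "t \<in> {1..T}" "\<omega> \<in> space M" for i t \<omega>
    unfolding G max_estimator_norm_def using that
    by (intro cSup_upper[OF _ bdd']) (auto simp: estimator_norms_def)
  have b: "0 \<le> \<beta>" by (rule \<beta>_nonneg[OF T])
  have V: "0 \<le> margin * optimum" using margin_nonneg optimum_nonneg by simp
  have err: "0 \<le> (G + \<beta> * D) * D * sqrt (real T)" using G0 b D_nonneg by simp
  show ?thesis
  \<comment> \<open>At \<open>1/12\<close> the factor \<open>1/4 - 3 * \<epsilon>\<close> vanishes;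
    beyond it the claimed lower bound is nonpositive.\<close>
  proof (cases "\<epsilon> < 1/12")
    case False
    then have "(1/4 - 3 * \<epsilon>) * (margin * optimum) \<le> 0" using V by (intro mult_nonpos_nonneg) auto
    then show ?thesis using err reward_nonneg[of L] by linarith
  next
    case True
    define R where "R = D * G * sqrt (2 * real T)"
    have R: "0 \<le> R" using D_nonneg G0 by (simp add: R_def)
    have bound: "(1 - 2 * \<epsilon>) ^ (L - 1) * ((1 + \<epsilon>) ^ L - 1) * (margin * optimum)
        - real L * (\<epsilon> * R + 0.5 * \<epsilon>\<^sup>2 * \<beta> * D\<^sup>2 * real T) \<le> reward L"
      using True R RFTL_has_regret[OF T _ Gb A] by (intro reward_bound) (auto simp: R_def)
    have "(1/4 - 3 * \<epsilon>) * (margin * optimum) \<le> (1 - 2 * \<epsilon>) ^ (L - 1) * ((1 + \<epsilon>) ^ L - 1) * (margin * optimum)"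
      using leading_factor_bound[OF \<epsilon>(1) True L] V by (rule mult_right_mono)
    moreover have "real L * (\<epsilon> * R + 0.5 * \<epsilon>\<^sup>2 * \<beta> * D\<^sup>2 * real T) \<le> (G + \<beta> * D) * D * sqrt (real T)"
    proof -
      have "0 \<le> \<lfloor>ln 2 / \<epsilon>\<rfloor>" using \<epsilon> by simp
      then have "real L \<le> ln 2 / \<epsilon>" unfolding L by (auto simp: of_nat_nat)
      then have "real L * \<epsilon> \<le> ln 2" using \<epsilon> by (simp add: pos_le_divide_eq)
      \<comment> \<open>With \<open>sqrt 2 \<le> 36/25\<close> this makes
        \<open>L * \<epsilon> * sqrt 2\<close> at most 1, absorbing the constant of the regret
        bound; half of \<open>L * \<epsilon>\<close> is likewise at most 1 in the smoothness
        error.\<close>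
      then have L\<epsilon>: "real L * \<epsilon> \<le> 25/36" using ln2_le_25_over_36 by linarith
      have "sqrt 2 \<le> (36/25 :: real)" by (rule real_le_lsqrt) (auto simp: power2_eq_square)
      then have "real L * \<epsilon> * sqrt 2 \<le> 25/36 * (36/25)" using L\<epsilon> \<epsilon> by (intro mult_mono) auto
      then have "real L * \<epsilon> * sqrt 2 * (D * G * sqrt (real T)) \<le> 1 * (D * G * sqrt (real T))"
        using D_nonneg G0 by (intro mult_right_mono) auto
      moreover have "real L * (\<epsilon> * R) = real L * \<epsilon> * sqrt 2 * (D * G * sqrt (real T))"
        by (simp add: R_def real_sqrt_mult)
      moreover have "\<epsilon> * real T = sqrt (real T)"
        using T by (simp add: eps real_div_sqrt)
      then have "real L * (0.5 * \<epsilon>\<^sup>2 * \<beta> * D\<^sup>2 * real T) = (0.5 * (real L * \<epsilon>)) * (\<beta> * D\<^sup>2 * sqrt (real T))"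
        by (simp add: power2_eq_square mult_ac flip: \<open>\<epsilon> * real T = sqrt (real T)\<close>)
      moreover have "(0.5 * (real L * \<epsilon>)) * (\<beta> * D\<^sup>2 * sqrt (real T)) \<le> 1 * (\<beta> * D\<^sup>2 * sqrt (real T))"
        using L\<epsilon> b by (intro mult_right_mono) auto
      moreover have "(G + \<beta> * D) * D * sqrt (real T) = D * G * sqrt (real T) + \<beta> * D\<^sup>2 * sqrt (real T)"
        by (simp add: algebra_simps power2_eq_square)
      ultimately show ?thesis unfolding distrib_left by linarith
    qed
    ultimately show ?thesis using bound by linarith
  qed
qed

end

section \<open>Assembly of the general and the specialized bound\<close>

theorem theorem4p1:
  fixes M :: "'w measure"
    and K :: "(real ^ 'n) set"
    and D \<beta> \<epsilon> :: real
    and L T :: nat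
    and F :: "nat \<Rightarrow> 'w \<Rightarrow> real ^ 'n \<Rightarrow> real"
    and E :: "nat \<Rightarrow> ('w, 'n) olo"
    and s y g :: "nat \<Rightarrow> nat \<Rightarrow> 'w \<Rightarrow> real ^ 'n"
    and opt :: "real ^ 'n"
  assumes "prob_space M"
    and "convex K" and "K \<subseteq> cbox 0 1" and "D = diameter K"
    and "\<And>t \<omega> x. t \<in> {1..T} \<Longrightarrow> \<omega> \<in> space M \<Longrightarrow> x \<in> cbox 0 1 \<Longrightarrow> 0 \<le> F t \<omega> x"
    and "\<And>t \<omega>. t \<in> {1..T} \<Longrightarrow> \<omega> \<in> space M \<Longrightarrow> smooth_on_cube \<beta> (F t \<omega>)"
    and "\<And>t \<omega>. t \<in> {1..T} \<Longrightarrow> \<omega> \<in> space M \<Longrightarrow> DR_submodular (F t \<omega>)"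
    and "\<And>t x. t \<in> {1..T} \<Longrightarrow> x \<in> cbox 0 1 \<Longrightarrow> (\<lambda>\<omega>. F t \<omega> x) \<in> borel_measurable M"
    and "\<And>t x. t \<in> {1..T} \<Longrightarrow> x \<in> K \<Longrightarrow> integrable M (\<lambda>\<omega>. F t \<omega> x)"
    and "NMMFW_run M K L \<epsilon> T F E s y g"
    and "is_arg_max (\<lambda>x. prob_space.expectation M (\<lambda>\<omega>. \<Sum>t=1..T. F t \<omega> x)) (\<lambda>x. x \<in> K) opt"
  shows
    "(\<forall>R \<ge> 0. 0 < \<epsilon> \<longrightarrow> \<epsilon> \<le> 1/2 \<longrightarrow> (\<forall>i \<in> {1..L}. has_regret M K T (s i) (g i) R) \<longrightarrow>
        (\<Sum>t=1..T. prob_space.expectation M (\<lambda>\<omega>. F t \<omega> (y L t \<omega>)))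
          \<ge> (1 - 2 * \<epsilon>) ^ (L - 1) * ((1 + \<epsilon>) ^ L - 1) * (1 - (INF x\<in>K. infnorm x))
              * prob_space.expectation M (\<lambda>\<omega>. \<Sum>t=1..T. F t \<omega> opt)
            - \<epsilon> * real L * R - 0.5 * \<epsilon>\<^sup>2 * \<beta> * D\<^sup>2 * real T * real L)
     \<and>
     (\<forall>G. 1 \<le> T \<longrightarrow> \<epsilon> = 1 / sqrt (real T) \<longrightarrow> L = nat \<lfloor>ln 2 / \<epsilon>\<rfloor> \<longrightarrow>
        bdd_above (estimator_norms M L T g) \<longrightarrow> G = max_estimator_norm M L T g \<longrightarrow>
        (\<forall>i \<in> {1..L}. \<forall>\<omega> \<in> space M. is_RFTL K T G (E i \<omega>)) \<longrightarrow>
        (\<Sum>t=1..T. prob_space.expectation M (\<lambda>\<omega>. F t \<omega> (y L t \<omega>)))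
          \<ge> (1/4 - 3 * \<epsilon>) * (1 - (INF x\<in>K. infnorm x))
              * prob_space.expectation M (\<lambda>\<omega>. \<Sum>t=1..T. F t \<omega> opt)
            - (G + \<beta> * D) * D * sqrt (real T))"
proof -
  have opt: "opt \<in> K" using assms(11) by (simp add: is_arg_max_def)
  have loc: "NMMFW M K D \<beta> \<epsilon> L T F E s y g opt" if "0 < \<epsilon>" "\<epsilon> \<le> 1"
    using assms opt that by (intro NMMFW.intro NMMFW_axioms.intro)
  show ?thesis
  proof (intro conjI allI impI, goal_cases)
    case (1 R)
    then interpret NMMFW M K D \<beta> \<epsilon> L T F E s y g opt by (intro loc) auto
    have "(1 - 2 * \<epsilon>) ^ (L - 1) * ((1 + \<epsilon>) ^ L - 1) * (margin * optimum)
      - real L * (\<epsilon> * R + 0.5 * \<epsilon>\<^sup>2 * \<beta> * D\<^sup>2 * real T) \<le> reward L"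
      using 1 by (intro reward_bound) auto
    then show ?case unfolding margin_def optimum_def reward_def by (simp add: algebra_simps)
  next
    case (2 G)
    \<comment> \<open>Since \<open>1 \<le> T\<close>, the choice
      \<open>\<epsilon> = 1 / sqrt (real T)\<close> lies in the range that the locale
      requires.\<close>
    then interpret NMMFW M K D \<beta> \<epsilon> L T F E s y g opt by (intro loc) auto
    have "(1/4 - 3 * \<epsilon>) * (margin * optimum) - (G + \<beta> * D) * D * sqrt (real T) \<le> reward L"
      using 2 by (intro RFTL_reward_bound) auto
    then show ?case unfolding margin_def optimum_def reward_def by (simp add: mult.assoc)
  qed
qed

end
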